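(* Let $X$ be a rearrangement invariant space over $(-1,1)$ satisfying $0<\underline{\alpha}_X\le\overline{\alpha}_X<1$. (i) Every $f\in L^1$ is $m_X^0$-integrable and $\int_Af\,dm_X^0=T(f\chi_A)\in L^0$ for $A\in\mathscr{B}$. (ii) If $f\in[T,X]\subseteq L^1$, then $\int_Af\,dm_X^0\in X$ for every $A\in\mathscr{B}$. So, the linear operator $T\colon[T,X]\to X$ admits the integral representation $$T(f)=\int_{-1}^1f\,dm_X^0\in X,\qquad f\in[T,X].$$
   Context: Let $\mu$ be Lebesgue measure on the Borel $\sigma$-algebra $\mathscr{B}$ of $(-1,1)$, let $\mathrm{sim}\,\mathscr{B}$ be the space of all $\mathbb{C}$-valued $\mathscr{B}$-simple functions, and let $L^0$ be the complex vector lattice of all $\mathbb{C}$-valued $\mathscr{B}$-measurable functions on $(-1,1)$ (functions equal a.e. are identified). $L^p$ means $L^p(-1,1)$. A Banach function space (B.f.s.) over $(-1,1)$ is an order ideal $X$ of $L^0$ with $\mathrm{sim}\,\mathscr{B}\subseteq X$, equipped with a lattice norm $\|\cdot\|_X$ for which $X$ is complete. It has the Fatou property if, whenever $\{f_n\}$ is a norm-bounded increasing sequence of positive functions in $X$ with $f=\sup_n f_n$ in $L^0$, then $f\in X$ and $\|f_n\|_X\to\|f\|_X$. For $f\in L^0$ the decreasing rearrangement $f^*\colon[0,2]\to[0,\infty]$ is the right continuous inverse of the distribution function $\lambda\mapsto\mu(\{|f|>\lambda\})$. A B.f.s. $X$ over $(-1,1)$ with the Fatou property is rearrangement invariant (r.i.)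 if $g\in L^0$ and $g^*\le f^*$ for some $f\in X$ imply $g\in X$. Then $L^\infty\subseteq X\subseteq L^1$ continuously. For $t>0$ the dilation operator $E_t\colon X\to X$ is $E_t(f)(x)=f(tx)$ if $-1<tx<1$ and $0$ otherwise. The Boyd indices are $\underline{\alpha}_X=\sup_{0<t<1}\frac{\log\|E_{1/t}\|_{\mathrm{op}}}{\log t}$ and $\overline{\alpha}_X=\inf_{1<t<\infty}\frac{\log\|E_{1/t}\|_{\mathrm{op}}}{\log t}$. The finite Hilbert transform of $f\in L^1$ is $T(f)(t)=\lim_{\varepsilon\to0+}\frac1\pi\left(\int_{-1}^{t-\varepsilon}+\int_{t+\varepsilon}^1\right)\frac{f(x)}{x-t}\,dx$, which exists for a.e. $t\in(-1,1)$; $T(f)\in L^0$. If $X$ is r.i. with $0<\underline{\alpha}_X\le\overline{\alpha}_X<1$, then $T$ maps $X$ boundedly into $X$ and $T_X\colon X\to X$ denotes this operator. Define $[T,X]=\{f\in L^1: T(h)\in X\text{ for all }h\in L^0\text{ with }|h|\le|f|\text{ a.e.}\}$ with norm $\|f\|_{[T,X]}=\sup_{|h|\le|f|}\|T(h)\|_X$. $L^0$ carries the topology of convergence in measure, defined by the $F$-norm $f\mapsto\int_{-1}^1\frac{|f|}{1+|f|}\,d\mu$, for which it is complete. $m_X^0\colon\mathscr{B}\to L^0$ denotes the ($\sigma$-additive) vector measure $A\mapsto T_X(\chi_A)$ regarded as $L^0$-valued. For $s=\sum_ja_j\chi_{A_j}\in\mathrm{sim}\,\mathscr{B}$ and $A\in\mathscr{B}$,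 $\int_As\,dm_X^0=\sum_ja_jm_X^0(A_j\cap A)$. A $\mathscr{B}$-measurable $f\colon(-1,1)\to\mathbb{C}$ is $m_X^0$-integrable if there is a sequence $\{s_n\}\subseteq\mathrm{sim}\,\mathscr{B}$ with $s_n\to f$ pointwise and such that for every $A\in\mathscr{B}$ the sequence $\{\int_As_n\,dm_X^0\}$ converges in $L^0$; then $\int_Af\,dm_X^0:=\lim_n\int_As_n\,dm_X^0$ in $L^0$ (independent of the choice of such a sequence). *)

theory Defs
  imports "HOL-Analysis.Analysis" "HOL-Library.Complex_Order" "HOL-Library.FuncSet"
begin

text \<open>
  Elements of \<open>L\<^sup>0\<close> are represented by measurable functions; identification of functions equal
  almost everywhere is expressed through \<open>AE\<close> statements.  The values of the representatives
  outside \<open>(-1,1)\<close> play no role.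
\<close>

abbreviation mu :: "real measure" where
  "mu \<equiv> restrict_space lborel {-1<..<1}"

abbreviation L0 :: "(real \<Rightarrow> complex) set" where
  "L0 \<equiv> borel_measurable mu"

text \<open>The order below is that of \<open>Complex_Order\<close>: \<open>w \<le> z\<close> iff \<open>z - w\<close> is real and nonnegative.\<close>

definition L0_le :: "(real \<Rightarrow> complex) \<Rightarrow> (real \<Rightarrow> complex) \<Rightarrow> bool" where
  "L0_le f g \<longleftrightarrow> (AE x in mu. f x \<le> g x)"

definition L0_is_sup :: "(nat \<Rightarrow> real \<Rightarrow> complex) \<Rightarrow> (real \<Rightarrow> complex) \<Rightarrow> bool" where
  "L0_is_sup F f \<longleftrightarrow> f \<in> L0 \<and> (\<forall>n. L0_le (F n) f) \<and>
     (\<forall>g\<in>L0. (\<forall>n. L0_le (F n) g) \<longrightarrow> L0_le f g)"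

text \<open>Only the values of \<open>N\<close> on \<open>X\<close> are meaningful.\<close>

locale banach_function_space =
  fixes X :: "(real \<Rightarrow> complex) set" and N :: "(real \<Rightarrow> complex) \<Rightarrow> real"
  assumes sub_L0: "X \<subseteq> L0"
    and add_closed: "f \<in> X \<Longrightarrow> g \<in> X \<Longrightarrow> (\<lambda>x. f x + g x) \<in> X"
    and scale_closed: "f \<in> X \<Longrightarrow> (\<lambda>x. c * f x) \<in> X"
    and solid: "f \<in> X \<Longrightarrow> g \<in> L0 \<Longrightarrow> (AE x in mu. norm (g x) \<le> norm (f x)) \<Longrightarrow> g \<in> X"
    and simple_mem: "simple_function mu s \<Longrightarrow> s \<in> X"
    and norm_nonneg: "f \<in> X \<Longrightarrow> 0 \<le> N f"
    and norm_zero_iff: "f \<in> X \<Longrightarrow> N f = 0 \<longleftrightarrow> (AE x in mu. f x = 0)"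
    and norm_scale: "f \<in> X \<Longrightarrow> N (\<lambda>x. c * f x) = norm c * N f"
    and norm_triangle: "f \<in> X \<Longrightarrow> g \<in> X \<Longrightarrow> N (\<lambda>x. f x + g x) \<le> N f + N g"
    and norm_lattice: "f \<in> X \<Longrightarrow> g \<in> X \<Longrightarrow> (AE x in mu. norm (g x) \<le> norm (f x)) \<Longrightarrow> N g \<le> N f"
    and norm_complete: "(\<And>n. F n \<in> X) \<Longrightarrow>
      (\<And>e. e > 0 \<Longrightarrow> \<exists>K. \<forall>m\<ge>K. \<forall>n\<ge>K. N (\<lambda>x. F m x - F n x) < e) \<Longrightarrow>
      \<exists>f\<in>X. (\<lambda>n. N (\<lambda>x. F n x - f x)) \<longlonglongrightarrow> 0"

definition fatou_property :: "(real \<Rightarrow> complex) set \<Rightarrow> ((real \<Rightarrow> complex) \<Rightarrow> real) \<Rightarrow> bool" where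
  "fatou_property X N \<longleftrightarrow>
     (\<forall>F f. (\<forall>n. F n \<in> X) \<and> (\<forall>n. L0_le (\<lambda>_. 0) (F n)) \<and> (\<forall>n. L0_le (F n) (F (Suc n))) \<and>
            (\<exists>C. \<forall>n. N (F n) \<le> C) \<and> L0_is_sup F f
        \<longrightarrow> f \<in> X \<and> (\<lambda>n. N (F n)) \<longlonglongrightarrow> N f)"

definition distribution_fun :: "(real \<Rightarrow> complex) \<Rightarrow> real \<Rightarrow> real" where
  "distribution_fun f l = measure mu {x \<in> space mu. l < norm (f x)}"

text \<open>The right continuous inverse of the distribution function; the infimum of the empty
  set is \<open>\<infinity>\<close>.\<close>

definition decr_rearrangement :: "(real \<Rightarrow> complex) \<Rightarrow> real \<Rightarrow> ennreal" where
  "decr_rearrangement f t = Inf (ennreal ` {l. 0 \<le> l \<and> distribution_fun f l \<le> t})"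

locale ri_space = banach_function_space +
  assumes fatou: "fatou_property X N"
    and rearrangement_invariant: "f \<in> X \<Longrightarrow> g \<in> L0 \<Longrightarrow>
      (\<And>t. t \<in> {0..2} \<Longrightarrow> decr_rearrangement g t \<le> decr_rearrangement f t) \<Longrightarrow> g \<in> X"

definition dilation :: "real \<Rightarrow> (real \<Rightarrow> complex) \<Rightarrow> real \<Rightarrow> complex" where
  "dilation t f x = (if -1 < t * x \<and> t * x < 1 then f (t * x) else 0)"

definition op_norm ::
  "(real \<Rightarrow> complex) set \<Rightarrow> ((real \<Rightarrow> complex) \<Rightarrow> real) \<Rightarrow>
   ((real \<Rightarrow> complex) \<Rightarrow> real \<Rightarrow> complex) \<Rightarrow> real" where
  "op_norm X N S = (SUP f\<in>{f\<in>X. N f \<le> 1}. N (S f))"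

text \<open>On an r.i. space the dilations are bounded, and \<open>t \<mapsto> op_norm X N (dilation (1/t))\<close>
  is submultiplicative on \<open>(0,1)\<close> and on \<open>(1,\<infinity>)\<close>; therefore the real suprema and the
  infimum occurring in these definitions are taken over bounded sets.\<close>

definition lower_boyd :: "(real \<Rightarrow> complex) set \<Rightarrow> ((real \<Rightarrow> complex) \<Rightarrow> real) \<Rightarrow> real" where
  "lower_boyd X N = (SUP t\<in>{0<..<1}. ln (op_norm X N (dilation (1 / t))) / ln t)"

definition upper_boyd :: "(real \<Rightarrow> complex) set \<Rightarrow> ((real \<Rightarrow> complex) \<Rightarrow> real) \<Rightarrow> real" where
  "upper_boyd X N = (INF t\<in>{1<..}. ln (op_norm X N (dilation (1 / t))) / ln t)"

definition truncated_hilbert :: "real \<Rightarrow> (real \<Rightarrow> complex) \<Rightarrow> real \<Rightarrow> complex" where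
  "truncated_hilbert e f t =
     of_real (1 / pi) *
       ((LINT x:{-1<..<t - e}|mu. f x / of_real (x - t)) +
        (LINT x:{t + e<..<1}|mu. f x / of_real (x - t)))"

text \<open>For integrable \<open>f\<close> the limit exists at almost every \<open>t\<close>; the value \<open>0\<close> on the
  exceptional null set is a convention.\<close>

definition finite_hilbert :: "(real \<Rightarrow> complex) \<Rightarrow> real \<Rightarrow> complex" where
  "finite_hilbert f t =
     (if \<exists>l. ((\<lambda>e. truncated_hilbert e f t) \<longlongrightarrow> l) (at_right 0)
      then Lim (at_right 0) (\<lambda>e. truncated_hilbert e f t) else 0)"

text \<open>The operator \<open>T\<^sub>X\<close>, the vector measure \<open>m\<^sub>X\<^sup>0\<close> and the optimal domain \<open>[T,X]\<close>.\<close>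

definition hilbert_on :: "(real \<Rightarrow> complex) set \<Rightarrow> (real \<Rightarrow> complex) \<Rightarrow> real \<Rightarrow> complex" where
  "hilbert_on X = restrict finite_hilbert X"

definition hilbert_measure :: "(real \<Rightarrow> complex) set \<Rightarrow> real set \<Rightarrow> real \<Rightarrow> complex" where
  "hilbert_measure X A = hilbert_on X (indicator A)"

definition hilbert_domain :: "(real \<Rightarrow> complex) set \<Rightarrow> (real \<Rightarrow> complex) set" where
  "hilbert_domain X =
     {f. integrable mu f \<and>
         (\<forall>h\<in>L0. (AE x in mu. norm (h x) \<le> norm (f x)) \<longrightarrow> finite_hilbert h \<in> X)}"

definition L0_fnorm :: "(real \<Rightarrow> complex) \<Rightarrow> real" where
  "L0_fnorm f = (LINT x|mu. norm (f x) / (1 + norm (f x)))"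

definition L0_tendsto :: "(nat \<Rightarrow> real \<Rightarrow> complex) \<Rightarrow> (real \<Rightarrow> complex) \<Rightarrow> bool" where
  "L0_tendsto F g \<longleftrightarrow> (\<forall>n. F n \<in> L0) \<and> g \<in> L0 \<and>
     (\<lambda>n. L0_fnorm (\<lambda>x. F n x - g x)) \<longlonglongrightarrow> 0"

text \<open>The integral of a simple function, computed from its canonical representation
  \<open>s = (\<Sum>a. a \<cdot> \<chi>\<^bsub>{s = a}\<^esub>)\<close>.\<close>

definition simple_vint ::
  "(real set \<Rightarrow> real \<Rightarrow> complex) \<Rightarrow> real set \<Rightarrow> (real \<Rightarrow> complex) \<Rightarrow> real \<Rightarrow> complex" where
  "simple_vint m A s t = (\<Sum>a\<in>s ` space mu. a * m ((s -` {a} \<inter> space mu) \<inter> A) t)"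

definition approximating ::
  "(real set \<Rightarrow> real \<Rightarrow> complex) \<Rightarrow> (real \<Rightarrow> complex) \<Rightarrow> (nat \<Rightarrow> real \<Rightarrow> complex) \<Rightarrow> bool" where
  "approximating m f s \<longleftrightarrow>
     (\<forall>n. simple_function mu (s n)) \<and>
     (\<forall>x\<in>space mu. (\<lambda>n. s n x) \<longlonglongrightarrow> f x) \<and>
     (\<forall>A\<in>sets mu. \<exists>g. L0_tendsto (\<lambda>n. simple_vint m A (s n)) g)"

definition vm_integrable :: "(real set \<Rightarrow> real \<Rightarrow> complex) \<Rightarrow> (real \<Rightarrow> complex) \<Rightarrow> bool" where
  "vm_integrable m f \<longleftrightarrow> f \<in> L0 \<and> (\<exists>s. approximating m f s)"

text \<open>The choice is among all limits obtained from all approximating sequences; hence an identity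
  for this integral (almost everywhere) can only be proved if the limit is independent of the
  sequence.\<close>

definition vm_integral ::
  "(real set \<Rightarrow> real \<Rightarrow> complex) \<Rightarrow> real set \<Rightarrow> (real \<Rightarrow> complex) \<Rightarrow> real \<Rightarrow> complex" where
  "vm_integral m A f =
     (SOME g. \<exists>s. approximating m f s \<and> L0_tendsto (\<lambda>n. simple_vint m A (s n)) g)"

end

theory Submission
  imports Defs "HOL-Complex_Analysis.Complex_Analysis" "HOL-Real_Asymp.Real_Asymp"
begin

text \<open>
  Two facts about the finite Hilbert transform \<open>T\<close> carry the theorem: for integrable \<open>f\<close> the
  principal value defining \<open>T f\<close> exists almost everywhere, and \<open>T\<close> is continuous from \<open>L\<^sup>1\<close> to
  \<open>L\<^sup>0\<close>. Both follow from one maximal inequality (\<open>weak_type_truncated\<close>): off a set of measure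
  \<open>O(\<parallel>f\<parallel>\<^sub>1 / l)\<close> all truncated transforms of \<open>f\<close> are bounded by \<open>l\<close>.

  The maximal inequality is obtained from complex analysis. For \<open>f \<ge> 0\<close> the truncation at distance \<open>e\<close>
  is dominated by the Cauchy transform \<open>F\<close> of \<open>f\<close> at \<open>t + i e\<close>, because the truncated kernel
  differs from the conjugate Poisson kernel by at most the Poisson kernel. Now \<open>F\<close> maps the upper
  half plane into the right half plane, so \<open>F / (F + l)\<close> is bounded by \<open>1\<close>, has nonnegative real
  part \<open>u\<close>, and \<open>u \<ge> 1/2\<close> wherever \<open>\<bar>F\<bar> \<ge> l\<close>. The function \<open>u\<close> is the Poisson integral of its
  values on each horizontal line, and the decay of \<open>F\<close> at infinity bounds the integral of these
  values by a multiple of \<open>\<parallel>f\<parallel>\<^sub>1 / l\<close>. A Vitali covering argument for Poisson integrals then controls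
  the set above which \<open>\<bar>F\<bar>\<close> exceeds \<open>l\<close> somewhere.

  Existence of the principal value is elementary for indicators of half lines, since there the
  truncations are eventually constant; it extends to indicators of Borel sets by a Dynkin argument
  and to \<open>L\<^sup>1\<close> by approximation, where the maximal inequality makes the exceptional sets null.

  With \<open>T\<close> continuous, a dominated simple approximation of \<open>f\<close> shows that \<open>f\<close> is integrable with
  respect to the vector measure with integral \<open>T (f \<chi>\<^sub>A)\<close>. The integral may, however, be computed
  along any sequence \<open>s\<^sub>n\<close> that converges pointwise and for which all \<open>T (s\<^sub>n \<chi>\<^sub>A)\<close> converge. That the
  limit is always \<open>T (f \<chi>\<^sub>A)\<close> is \<open>finite_hilbert_setwise_limit_zero\<close>, applied to \<open>u\<^sub>n = s\<^sub>n - f\<close>: along a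
  subsequence, up to \<open>L\<^sup>1\<close>-small errors, \<open>u\<^sub>n\<close> lives on pairwise disjoint sets \<open>D\<^sub>n\<close>. On the union of
  the \<open>D\<^sub>n\<close> with even index the odd-numbered transforms tend to \<open>0\<close>, so the assumed limit there is \<open>0\<close>,
  and the even-numbered transforms show that the limit over \<open>A\<close> is the same.

  The second part of the theorem follows from the first, because the optimal domain is defined by
  \<open>T h \<in> X\<close> for all \<open>h\<close> dominated by \<open>f\<close>, and \<open>f \<chi>\<^sub>A\<close> is such a function.
\<close>

section \<open>The Poisson integral of a bounded holomorphic function\<close>

lemma poisson_kernel_cauchy:
  assumes "w \<noteq> z" "w \<noteq> cnj z"
  shows "1 / (w - z) - 1 / (w - cnj z) = 2 * \<i> * of_real (Im z) / ((w - z) * (w - cnj z))"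
proof -
  have "1 / (w - z) - 1 / (w - cnj z) = (z - cnj z) / ((w - z) * (w - cnj z))"
    using assms by (simp add: diff_frac_eq)
  also have "z - cnj z = 2 * \<i> * of_real (Im z)"
    by (simp add: complex_eq_iff)
  finally show ?thesis .
qed

text \<open>
  Cauchy's formula on the boundary of the rectangle with corners \<open>\<plusminus>R\<close> and \<open>\<plusminus>R + i R\<close>, with the Cauchy
  kernel of the conjugate point subtracted: that point lies outside, so nothing is lost, and the
  difference of the kernels is of order \<open>y / R\<^sup>2\<close> on the three distant sides while on the real axis it
  is \<open>2 i\<close> times the Poisson kernel.
\<close>

lemma poisson_half_plane_estimate:
  fixes G :: "complex \<Rightarrow> complex"
  assumes hol: "G holomorphic_on {w. - d < Im w}" and d: "0 < d"
    and bdd: "\<And>w. - d < Im w \<Longrightarrow> norm (G w) \<le> 1"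
    and y: "0 < y" and R: "2 * norm (Complex x y) < R"
  shows "\<bar>integral {-R..R} (\<lambda>t. y * Re (G (of_real t)) / ((t - x)\<^sup>2 + y\<^sup>2)) - pi * Re (G (Complex x y))\<bar>
           \<le> 16 * y / R"
proof -
  define z where "z = Complex x y"
  define S where "S = {w. - d < Im w}"
  define K where "K w = G w / (w - z) - G w / (w - cnj z)" for w
  have Rpos: "0 < R" using R norm_ge_zero[of "Complex x y"] by linarith
  have Re_z: "\<bar>x\<bar> < R" and Im_z: "y < R"
    using R abs_Re_le_cmod[of "Complex x y"] abs_Im_le_cmod[of "Complex x y"] y by auto
  define a1 a2 a3 a4 where "a1 = complex_of_real (-R)" and "a2 = complex_of_real R"
    and "a3 = Complex R R" and "a4 = Complex (-R) R"
  have openS: "open S" and convS: "convex S"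
    unfolding S_def by (simp_all add: open_halfspace_Im_gt convex_halfspace_Im_gt)
  have pim: "path_image (rectpath a1 a3) = cbox a1 a3 - box a1 a3"
    using Rpos by (intro path_image_rectpath_cbox_minus_box) (auto simp: a1_def a3_def)
  have zbox: "z \<in> box a1 a3"
    using Re_z Im_z y by (auto simp: z_def a1_def a3_def in_box_complex_iff)
  have czbox: "cnj z \<notin> cbox a1 a3"
    using y by (auto simp: z_def a1_def a3_def in_cbox_complex_iff)
  have pS: "path_image (rectpath a1 a3) \<subseteq> S"
    unfolding pim using d by (auto simp: S_def a1_def a3_def in_cbox_complex_iff)
  have zS: "z \<in> interior S"
    using y d openS by (simp add: interior_open S_def z_def)
  have 1: "((\<lambda>w. G w / (w - z)) has_contour_integral 2 * pi * \<i> * G z) (rectpath a1 a3)"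
    using Cauchy_integral_formula_convex_simple[OF convS hol[folded S_def] zS, of "rectpath a1 a3"]
      pS pim zbox by (auto simp: winding_number_rectpath)
  have 2: "((\<lambda>w. G w / (w - cnj z)) has_contour_integral 0) (rectpath a1 a3)"
  proof (rule Cauchy_theorem_convex_simple)
    define T where "T = {w. max (- d) (- y) < Im w}"
    show "(\<lambda>w. G w / (w - cnj z)) holomorphic_on T"
      by (intro holomorphic_intros holomorphic_on_subset[OF hol]) (auto simp: T_def z_def)
    show "convex T" unfolding T_def by (rule convex_halfspace_Im_gt)
    show "path_image (rectpath a1 a3) \<subseteq> T"
      unfolding pim using d y by (auto simp: T_def a1_def a3_def in_cbox_complex_iff)
  qed auto
  have K: "(K has_contour_integral 2 * pi * \<i> * G z) (rectpath a1 a3)"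
    using has_contour_integral_diff[OF 1 2] by (simp add: K_def[abs_def])
  have seg: "closed_segment p q \<subseteq> cbox a1 a3 - box a1 a3" 
    if "(p,q) \<in> {(a1,a2),(a2,a3),(a3,a4),(a4,a1)}" for p q
  proof -
    have "path_image (linepath p q) \<subseteq> path_image (rectpath a1 a3)"
      using that
      by (auto simp: rectpath_def Let_def path_image_join a1_def a2_def a3_def a4_def complex_of_real_def)
    then show ?thesis by (simp add: pim)
  qed
  have nz: "w \<noteq> z" "w \<noteq> cnj z" "w \<in> S" if "w \<in> cbox a1 a3 - box a1 a3" for w
    using that zbox czbox pS pim by auto
  have contK: "continuous_on (cbox a1 a3 - box a1 a3) K"
    unfolding K_def using nz
    by (intro continuous_intros holomorphic_on_imp_continuous_on[OF holomorphic_on_subset[OF hol]])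
       (auto simp: S_def)
  have ci: "K contour_integrable_on linepath p q" if "(p,q) \<in> {(a1,a2),(a2,a3),(a3,a4),(a4,a1)}" for p q
    by (intro contour_integrable_continuous_linepath continuous_on_subset[OF contK] seg that)
  \<comment> \<open>On the three distant sides both kernels have poles at distance at least \<open>R / 2\<close>.\<close>
  have K_le: "norm (K w) \<le> 8 * y / R\<^sup>2" if w: "w \<in> S" "R \<le> norm w" for w
  proof -
    have nw: "R / 2 \<le> norm (w - z)" "R / 2 \<le> norm (w - cnj z)"
      using w R norm_triangle_ineq2[of w z] norm_triangle_ineq2[of w "cnj z"]
      by (auto simp: z_def)
    then have ne: "w \<noteq> z" "w \<noteq> cnj z" using Rpos by auto
    have "K w = G w * (1 / (w - z) - 1 / (w - cnj z))"
      by (simp add: K_def algebra_simps)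
    also have "\<dots> = G w * (2 * \<i> * of_real y / ((w - z) * (w - cnj z)))"
      by (subst poisson_kernel_cauchy[OF ne]) (simp add: z_def)
    finally have "norm (K w) = norm (G w) * (2 * y / (norm (w - z) * norm (w - cnj z)))"
      using y by (simp add: norm_mult norm_divide)
    also have "\<dots> \<le> 1 * (2 * y / ((R/2) * (R/2)))"
      using nw Rpos y bdd[of w] w ne
      by (intro mult_mono divide_left_mono) (auto simp: S_def zero_less_mult_iff)
    finally show ?thesis by (simp add: power2_eq_square)
  qed
  have side: "norm (contour_integral (linepath p q) K) \<le> 8 * y / R\<^sup>2 * norm (q - p)"
    if pq: "(p,q) \<in> {(a2,a3),(a3,a4),(a4,a1)}" for p q
  proof (rule contour_integral_bound_linepath)
    show "K contour_integrable_on linepath p q" using ci pq by auto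
    show "0 \<le> 8 * y / R\<^sup>2" using y by simp
    show "norm (K w) \<le> 8 * y / R\<^sup>2" if w: "w \<in> closed_segment p q" for w
    proof (rule K_le)
      have "w \<in> cbox a1 a3 - box a1 a3" using w seg[of p q] pq by auto
      then show "w \<in> S" by (rule nz)
      have "\<bar>Re w\<bar> = R \<or> \<bar>Im w\<bar> = R"
        using w pq Rpos by (auto simp: a1_def a2_def a3_def a4_def closed_segment_same_Re
             closed_segment_same_Im)
      then show "R \<le> norm w"
        using abs_Re_le_cmod[of w] abs_Im_le_cmod[of w] by auto
    qed
  qed
  have "rectpath a1 a3 = linepath a1 a2 +++ linepath a2 a3 +++ linepath a3 a4 +++ linepath a4 a1"
    by (simp add: rectpath_def Let_def a1_def a2_def a3_def a4_def complex_of_real_def)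
  then have "contour_integral (rectpath a1 a3) K = contour_integral (linepath a1 a2) K + 
     (contour_integral (linepath a2 a3) K + (contour_integral (linepath a3 a4) K + contour_integral (linepath a4 a1) K))"
    using ci by (simp add: contour_integrable_joinI)
  then have "2 * pi * \<i> * G z = contour_integral (linepath a1 a2) K + 
     (contour_integral (linepath a2 a3) K + contour_integral (linepath a3 a4) K + contour_integral (linepath a4 a1) K)"
    using contour_integral_unique[OF K] by simp
  then have "contour_integral (linepath a1 a2) K - 2 * pi * \<i> * G z = 
     - (contour_integral (linepath a2 a3) K + contour_integral (linepath a3 a4) K + contour_integral (linepath a4 a1) K)"
    by simp
  then have "norm (contour_integral (linepath a1 a2) K - 2 * pi * \<i> * G z) = 
     norm (contour_integral (linepath a2 a3) K + contour_integral (linepath a3 a4) K + contour_integral (linepath a4 a1) K)"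
    by (simp only: norm_minus_cancel)
  also have "\<dots> \<le> 8 * y / R\<^sup>2 * norm (a3 - a2) + 8 * y / R\<^sup>2 * norm (a4 - a3) + 8 * y / R\<^sup>2 * norm (a1 - a4)"
    by (intro norm_triangle_le add_mono side) auto
  also have "\<dots> = 32 * y / R"
  proof -
    have "norm (a3 - a2) = R" "norm (a4 - a3) = 2 * R" "norm (a1 - a4) = R"
      using Rpos by (simp_all add: a1_def a2_def a3_def a4_def complex_of_real_def cmod_def minus_complex.code real_sqrt_mult)
    then show ?thesis using Rpos by (simp add: field_simps power2_eq_square)
  qed
  finally have est: "norm (contour_integral (linepath a1 a2) K - 2 * pi * \<i> * G z) \<le> 32 * y / R" .
  have "(K has_contour_integral contour_integral (linepath a1 a2) K) (linepath a1 a2)"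
    using ci by (simp add: has_contour_integral_integral)
  then have hK: "((\<lambda>t. K (of_real t)) has_integral contour_integral (linepath a1 a2) K) {-R..R}"
    using Rpos by (subst (asm) has_contour_integral_linepath_Reals_iff) (auto simp: a1_def a2_def)
  have hI: "((\<lambda>t. Im (K (of_real t))) has_integral Im (contour_integral (linepath a1 a2) K)) {-R..R}"
    using has_integral_linear[OF hK bounded_linear_Im] by (simp add: o_def)
  \<comment> \<open>Dividing by \<open>2 i\<close> turns the real part of the value of \<open>G\<close> into the imaginary part of \<open>K\<close>.\<close>
  have ImK: "Im (K (of_real t)) / 2 = y * Re (G (of_real t)) / ((t - x)\<^sup>2 + y\<^sup>2)" for t
  proof -
    have ne: "of_real t \<noteq> z" "of_real t \<noteq> cnj z" using y by (auto simp: z_def complex_eq_iff)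
    have "K (of_real t) = G (of_real t) * (1 / (of_real t - z) - 1 / (of_real t - cnj z))"
      by (simp add: K_def algebra_simps)
    also have "\<dots> = G (of_real t) * (2 * \<i> * of_real y / ((of_real t - z) * (of_real t - cnj z)))"
      by (subst poisson_kernel_cauchy[OF ne]) (simp add: z_def)
    also have "(of_real t - z) * (of_real t - cnj z) = of_real ((t - x)\<^sup>2 + y\<^sup>2)"
      by (simp add: z_def complex_eq_iff power2_eq_square algebra_simps)
    finally have e: "K (of_real t) = G (of_real t) * (2 * \<i> * of_real y / of_real ((t - x)\<^sup>2 + y\<^sup>2))" .
    have "Im (g * (2 * \<i> * of_real y / of_real p)) / 2 = y * Re g / p" for g p
      by simp
    then show ?thesis unfolding e .
  qed
  have "integral {-R..R} (\<lambda>t. y * Re (G (of_real t)) / ((t - x)\<^sup>2 + y\<^sup>2)) = Im (contour_integral (linepath a1 a2) K) / 2"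
  proof (rule integral_unique)
    have "((\<lambda>t. Im (K (of_real t)) / 2) has_integral Im (contour_integral (linepath a1 a2) K) / 2) {-R..R}"
      by (intro has_integral_divide hI)
    then show "((\<lambda>t. y * Re (G (of_real t)) / ((t - x)\<^sup>2 + y\<^sup>2)) has_integral
       Im (contour_integral (linepath a1 a2) K) / 2) {-R..R}"
      by (simp only: ImK)
  qed
  moreover have "\<bar>Im (contour_integral (linepath a1 a2) K) - 2 * pi * Re (G z)\<bar> \<le> 32 * y / R"
    using est abs_Im_le_cmod[of "contour_integral (linepath a1 a2) K - 2 * pi * \<i> * G z"] by simp
  ultimately show ?thesis
    unfolding z_def[symmetric] by (simp add: abs_if split: if_splits)
qed

section \<open>A covering estimate for Poisson integrals\<close>

text \<open>
  Every point of \<open>E\<close> is the centre of an interval whose length is controlled by its \<open>\<nu>\<close>-mass. A disjoint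
  Vitali subfamily of these intervals, enlarged five times, still covers \<open>E\<close>, and the masses of disjoint
  intervals add up to at most the total mass.
\<close>

lemma vitali_weak_type:
  fixes \<nu> :: "real measure"
  assumes sets: "sets \<nu> = sets borel" and mass: "emeasure \<nu> UNIV \<le> ennreal M"
    and c: "0 < c" and M: "0 \<le> M"
    and E: "\<And>x. x \<in> E \<Longrightarrow> \<exists>r>0. ennreal (c * r) \<le> emeasure \<nu> (ball x r)"
  shows "\<exists>B\<in>sets borel. E \<subseteq> B \<and> emeasure lborel B \<le> ennreal (10 * M / c)"
proof -
  obtain r where r: "\<And>x. x \<in> E \<Longrightarrow> 0 < r x" "\<And>x. x \<in> E \<Longrightarrow> ennreal (c * r x) \<le> emeasure \<nu> (ball x (r x))"
    using E by metis
  have bound: "0 < r x \<and> r x \<le> M / c" if "x \<in> E" for x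
  proof -
    have "emeasure \<nu> (ball x (r x)) \<le> emeasure \<nu> UNIV"
      by (intro emeasure_mono) (simp_all add: sets)
    then have "ennreal (c * r x) \<le> ennreal M"
      using r(2)[OF that] mass by (metis order_trans)
    then have "c * r x \<le> M" using M by (simp add: ennreal_le_iff)
    then show ?thesis using r(1)[OF that] c by (simp add: field_simps)
  qed
  obtain C where C: "countable C" "C \<subseteq> E"
    and disj: "pairwise (\<lambda>i j. disjnt (cball i (r i)) (cball j (r j))) C"
    and cov: "\<And>i. i \<in> E \<Longrightarrow> \<exists>j. j \<in> C \<and> \<not> disjnt (cball i (r i)) (cball j (r j)) \<and> cball i (r i) \<subseteq> ball j (5 * r j)"
    using Vitali_covering_lemma_cballs_balls[of E r "M/c" "\<lambda>x. x", OF bound] by blast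
  \<comment> \<open>The countable family is indexed by natural numbers, with empty sets at unused indices, so
    that countable subadditivity and additivity apply.\<close>
  define I where "I = to_nat_on C ` C"
  define A where "A n = (if n \<in> I then ball (from_nat_into C n) (5 * r (from_nat_into C n)) else {})" for n
  define D where "D n = (if n \<in> I then ball (from_nat_into C n) (r (from_nat_into C n)) else {})" for n
  have fC: "from_nat_into C n \<in> C" if "n \<in> I" for n
    using that C by (auto simp: I_def)
  have UA: "(\<Union>n. A n) = (\<Union>x\<in>C. ball x (5 * r x))"
    using C by (force simp: A_def I_def)
  have "E \<subseteq> (\<Union>n. A n)"
  proof
    fix x assume "x \<in> E"
    then obtain j where "j \<in> C" "cball x (r x) \<subseteq> ball j (5 * r j)" using cov by blast
    moreover have "x \<in> cball x (r x)" using r(1)[OF \<open>x \<in> E\<close>] by simp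
    ultimately show "x \<in> (\<Union>n. A n)" unfolding UA by blast
  qed
  moreover have "(\<Union>n. A n) \<in> sets borel" by (auto simp: A_def)
  moreover have "emeasure lborel (\<Union>n. A n) \<le> ennreal (10 * M / c)"
  proof -
    have "emeasure lborel (\<Union>n. A n) \<le> (\<Sum>n. emeasure lborel (A n))"
      by (intro emeasure_subadditive_countably) (auto simp: A_def)
    also have "\<dots> \<le> (\<Sum>n. ennreal (10 / c) * emeasure \<nu> (D n))"
    proof (intro suminf_le allI)
      fix n show "emeasure lborel (A n) \<le> ennreal (10 / c) * emeasure \<nu> (D n)"
      proof (cases "n \<in> I")
        case True
        define x where "x = from_nat_into C n"
        have x: "x \<in> E" using fC[OF True] C by (auto simp: x_def)
        have "emeasure lborel (A n) = ennreal (10 * r x)"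
          using True r(1)[OF x] by (simp add: A_def x_def[symmetric] ball_eq_greaterThanLessThan)
        also have "\<dots> = ennreal (10 / c) * ennreal (c * r x)"
          using c r(1)[OF x] by (subst ennreal_mult[symmetric]) auto
        also have "\<dots> \<le> ennreal (10 / c) * emeasure \<nu> (D n)"
          using True r(2)[OF x] by (intro mult_left_mono) (auto simp: D_def x_def)
        finally show ?thesis .
      qed (simp add: A_def)
    qed auto
    also have "\<dots> = ennreal (10 / c) * (\<Sum>n. emeasure \<nu> (D n))"
      by simp
    also have "(\<Sum>n. emeasure \<nu> (D n)) = emeasure \<nu> (\<Union>n. D n)"
    proof (rule suminf_emeasure)
      show "range D \<subseteq> sets \<nu>" by (auto simp: D_def sets)
      show "disjoint_family D"
      proof (unfold disjoint_family_on_def, intro ballI impI)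
        fix m n :: nat assume "m \<noteq> n"
        show "D m \<inter> D n = {}"
        proof (cases "m \<in> I \<and> n \<in> I")
          case True
          then have "from_nat_into C m \<noteq> from_nat_into C n"
            using \<open>m \<noteq> n\<close> C by (auto simp: I_def)
          with disj fC True have "disjnt (cball (from_nat_into C m) (r (from_nat_into C m)))
             (cball (from_nat_into C n) (r (from_nat_into C n)))"
            by (auto simp: pairwise_def)
          moreover have "D m \<subseteq> cball (from_nat_into C m) (r (from_nat_into C m))"
            and "D n \<subseteq> cball (from_nat_into C n) (r (from_nat_into C n))"
            by (auto simp: D_def)
          ultimately show ?thesis unfolding disjnt_def by blast
        qed (auto simp: D_def)
      qed
    qed
    also have "\<dots> \<le> emeasure \<nu> UNIV"
      by (intro emeasure_mono) (auto simp: sets)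
    also note mass
    finally have "emeasure lborel (\<Union>n. A n) \<le> ennreal (10 / c) * ennreal M"
      by (simp add: mult_left_mono)
    then show ?thesis using c M by (simp add: ennreal_mult[symmetric])
  qed
  ultimately show ?thesis by blast
qed

text \<open>
  On the dyadic annulus \<open>2\<^sup>k\<^sup>-\<^sup>1 y \<le> \<bar>t - x\<bar> < 2\<^sup>k y\<close> the term with index \<open>k\<close> alone majorises the Poisson
  kernel, and for \<open>k = 0\<close> it does so on the whole ball of radius \<open>y\<close>; the balls, unlike the annuli, are what the covering estimate measures.
\<close>

lemma poisson_kernel_le_dyadic:
  fixes x y t :: real
  assumes y: "0 < y"
  shows "ennreal (y / ((t - x)\<^sup>2 + y\<^sup>2)) \<le> (\<Sum>k. ennreal (4 / (4 ^ k * y)) * indicator (ball x (2 ^ k * y)) t)"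
proof -
  have "\<exists>k. \<bar>t - x\<bar> < 2 ^ k * y"
    using real_arch_pow[of 2 "\<bar>t - x\<bar> / y"] y by (auto simp: field_simps)
  define k where "k = (LEAST k. \<bar>t - x\<bar> < 2 ^ k * y)"
  have k: "\<bar>t - x\<bar> < 2 ^ k * y"
    unfolding k_def by (rule LeastI_ex) fact
  have "y / ((t - x)\<^sup>2 + y\<^sup>2) \<le> 4 / (4 ^ k * y)"
  proof (cases k)
    case 0
    have "y / ((t - x)\<^sup>2 + y\<^sup>2) \<le> y / y\<^sup>2"
      using y by (intro divide_left_mono) (auto intro!: mult_pos_pos add_nonneg_pos)
    also have "\<dots> \<le> 4 / y" using y by (simp add: power2_eq_square field_simps)
    finally show ?thesis using 0 by simp
  next
    case (Suc j)
    have "\<not> \<bar>t - x\<bar> < 2 ^ j * y"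
      using Suc not_less_Least[of j "\<lambda>k. \<bar>t - x\<bar> < 2 ^ k * y"] by (simp add: k_def)
    then have "(2 ^ j * y)\<^sup>2 \<le> \<bar>t - x\<bar>\<^sup>2"
      using y by (intro power_mono) auto
    moreover have "(2 ^ j * y)\<^sup>2 = 4 ^ j * y\<^sup>2"
      by (simp add: power_mult_distrib power_mult[symmetric] mult.commute[of j 2] power_mult[of 2 2])
    ultimately have "4 ^ j * y\<^sup>2 \<le> (t - x)\<^sup>2 + y\<^sup>2"
      by (simp add: add_increasing2)
    then have "y / ((t - x)\<^sup>2 + y\<^sup>2) \<le> y / (4 ^ j * y\<^sup>2)"
      using y by (intro divide_left_mono) (auto intro!: mult_pos_pos add_nonneg_pos)
    also have "\<dots> = 4 / (4 ^ k * y)"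
      using y Suc by (simp add: power2_eq_square field_simps)
    finally show ?thesis .
  qed
  then have "ennreal (y / ((t - x)\<^sup>2 + y\<^sup>2)) \<le> ennreal (4 / (4 ^ k * y)) * indicator (ball x (2 ^ k * y)) t"
    using k by (simp add: dist_real_def abs_minus_commute ennreal_leI)
  also have "\<dots> \<le> (\<Sum>k. ennreal (4 / (4 ^ k * y)) * indicator (ball x (2 ^ k * y)) t)"
  proof -
    define f where "f k = ennreal (4 / (4 ^ k * y)) * indicator (ball x (2 ^ k * y)) t" for k
    have "f k \<le> suminf f" using sum_le_suminf[of f "{k}"] by simp
    then show ?thesis by (simp add: f_def[abs_def])
  qed
  finally show ?thesis .
qed

text \<open>
  The contrapositive is what gets used: if a Poisson integral is large at some height above \<open>x\<close>, then
  some interval centred at \<open>x\<close> carries a large share of the mass.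
\<close>

lemma poisson_integral_le:
  fixes \<nu> :: "real measure"
  assumes sets: "sets \<nu> = sets borel" and y: "0 < y" and c: "0 \<le> c"
    and small: "\<And>r. 0 < r \<Longrightarrow> emeasure \<nu> (ball x r) \<le> ennreal (c * r)"
  shows "(\<integral>\<^sup>+ t. ennreal (y / ((t - x)\<^sup>2 + y\<^sup>2)) \<partial>\<nu>) \<le> ennreal (8 * c)"
proof -
  have ms[measurable_cong]: "sets \<nu> = sets borel" by fact
  have "(\<integral>\<^sup>+ t. ennreal (y / ((t - x)\<^sup>2 + y\<^sup>2)) \<partial>\<nu>)
      \<le> (\<integral>\<^sup>+ t. (\<Sum>k. ennreal (4 / (4 ^ k * y)) * indicator (ball x (2 ^ k * y)) t) \<partial>\<nu>)"
    by (intro nn_integral_mono poisson_kernel_le_dyadic y)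
  also have "\<dots> = (\<Sum>k. \<integral>\<^sup>+ t. ennreal (4 / (4 ^ k * y)) * indicator (ball x (2 ^ k * y)) t \<partial>\<nu>)"
    by (intro nn_integral_suminf borel_measurable_times_ennreal borel_measurable_const
          borel_measurable_indicator) (auto simp: sets)
  also have "\<dots> = (\<Sum>k. ennreal (4 / (4 ^ k * y)) * emeasure \<nu> (ball x (2 ^ k * y)))"
    by (subst nn_integral_cmult_indicator) (auto simp: sets)
  also have "\<dots> \<le> (\<Sum>k. ennreal (4 * c * (1/2) ^ k))"
  proof (intro suminf_le allI)
    fix k :: nat
    have "ennreal (4 / (4 ^ k * y)) * emeasure \<nu> (ball x (2 ^ k * y))
       \<le> ennreal (4 / (4 ^ k * y)) * ennreal (c * (2 ^ k * y))"
      using y by (intro mult_left_mono small) auto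
    also have "\<dots> = ennreal (4 / (4 ^ k * y) * (c * (2 ^ k * y)))"
      using y c by (intro ennreal_mult[symmetric]) auto
    also have "4 / (4 ^ k * y) * (c * (2 ^ k * y)) = 4 * c * (1/2) ^ k"
    proof -
      have "(4::real) ^ k = 2 ^ k * 2 ^ k" by (simp add: power_mult_distrib[symmetric])
      then show ?thesis using y by (simp add: field_simps)
    qed
    finally show "ennreal (4 / (4 ^ k * y)) * emeasure \<nu> (ball x (2 ^ k * y)) \<le> ennreal (4 * c * (1/2) ^ k)" .
  qed auto
  also have "\<dots> = ennreal (8 * c)"
  proof (rule suminf_ennreal_eq)
    show "(\<lambda>k. 4 * c * (1/2) ^ k) sums (8 * c)"
      using sums_mult[OF geometric_sums[of "1/2::real"], of "4 * c"] by simp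
  qed (use c in auto)
  finally show ?thesis .
qed

section \<open>Weak type for holomorphic functions with nonnegative real part\<close>

text \<open>
  The map \<open>\<zeta> \<mapsto> \<zeta> / (\<zeta> + l)\<close> sends the right half plane into the part of the unit disc with nonnegative
  real part. Its real part is a smooth substitute for the indicator of \<open>{\<bar>\<zeta>\<bar> \<ge> l}\<close>: harmonic, at
  least \<open>1/2\<close> on that set, and at most \<open>\<bar>\<zeta>\<bar> / l\<close>.
\<close>

lemma cayley_bounds:
  fixes \<zeta> :: complex and l :: real
  assumes "0 \<le> Re \<zeta>" "0 < l"
  shows "\<zeta> + of_real l \<noteq> 0"
    and "norm (\<zeta> / (\<zeta> + of_real l)) \<le> 1"
    and "0 \<le> Re (\<zeta> / (\<zeta> + of_real l))"
    and "l \<le> norm \<zeta> \<Longrightarrow> 1/2 \<le> Re (\<zeta> / (\<zeta> + of_real l))"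
    and "Re (\<zeta> / (\<zeta> + of_real l)) \<le> norm \<zeta> / l"
proof -
  obtain a b where \<zeta>: "\<zeta> = Complex a b" by (cases \<zeta>)
  have a: "0 \<le> a" using assms \<zeta> by simp
  show ne: "\<zeta> + of_real l \<noteq> 0"
    using assms by (auto simp: complex_eq_iff)
  have le: "l \<le> norm (\<zeta> + of_real l)"
    using abs_Re_le_cmod[of "\<zeta> + of_real l"] assms by simp
  have "norm \<zeta> \<le> norm (\<zeta> + of_real l)"
    unfolding \<zeta> cmod_def using a assms by (auto intro!: power_mono)
  then show "norm (\<zeta> / (\<zeta> + of_real l)) \<le> 1"
    using ne by (simp add: norm_divide)
  have den: "0 < (a + l)\<^sup>2 + b\<^sup>2" using a assms by (intro add_pos_nonneg) auto
  have Re: "Re (\<zeta> / (\<zeta> + of_real l)) = (a * (a + l) + b\<^sup>2) / ((a + l)\<^sup>2 + b\<^sup>2)"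
    by (simp add: Re_divide \<zeta> power2_eq_square)
  show "0 \<le> Re (\<zeta> / (\<zeta> + of_real l))"
    unfolding Re using a assms den by (intro divide_nonneg_pos) auto
  show "1/2 \<le> Re (\<zeta> / (\<zeta> + of_real l))" if "l \<le> norm \<zeta>"
  proof -
    have "l\<^sup>2 \<le> (norm \<zeta>)\<^sup>2" using that assms by (intro power_mono) auto
    then have "l\<^sup>2 \<le> a\<^sup>2 + b\<^sup>2" by (simp add: \<zeta> cmod_power2)
    then have "(a + l)\<^sup>2 + b\<^sup>2 \<le> 2 * (a * (a + l) + b\<^sup>2)"
      by (simp add: power2_eq_square algebra_simps)
    then show ?thesis unfolding Re using den by (simp add: field_simps)
  qed
  have "Re (\<zeta> / (\<zeta> + of_real l)) \<le> norm \<zeta> / norm (\<zeta> + of_real l)"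
    using complex_Re_le_cmod[of "\<zeta> / (\<zeta> + of_real l)"] by (simp add: norm_divide)
  also have "\<dots> \<le> norm \<zeta> / l"
    using le assms ne by (intro divide_left_mono mult_pos_pos) auto
  finally show "Re (\<zeta> / (\<zeta> + of_real l)) \<le> norm \<zeta> / l" .
qed

text \<open>
  Shifting \<open>F\<close> down by \<open>d\<close> makes it holomorphic across the real axis. The real part \<open>u\<close> of
  \<open>F / (F + l)\<close> on the line at height \<open>d\<close> then serves as a density: its total mass is at most
  \<open>2 \<pi> m / l\<close> by the decay of \<open>F\<close>, and a point above which \<open>\<bar>F\<bar>\<close> exceeds \<open>l\<close> at some height greater
  than \<open>d\<close> has a Poisson integral of at least \<open>\<pi>/2\<close>, hence is the centre of an interval of large mass.
\<close>

lemma weak_type_above_height: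
  fixes F :: "complex \<Rightarrow> complex"
  assumes hol: "F holomorphic_on {z. 0 < Im z}"
    and Re: "\<And>z. 0 < Im z \<Longrightarrow> 0 \<le> Re (F z)"
    and decay: "\<And>z. 0 < Im z \<Longrightarrow> norm (F z) \<le> m / Im z"
    and l: "0 < l" and d: "0 < d"
  shows "\<exists>B\<in>sets borel. {x. \<exists>y>d. l < norm (F (Complex x y))} \<subseteq> B \<and>
           emeasure lborel B \<le> ennreal (160 * pi * m / l)"
proof -
  have m: "0 \<le> m" using order_trans[OF norm_ge_zero decay[of \<i>]] by simp
  define G where "G w = F (w + of_real d * \<i>) / (F (w + of_real d * \<i>) + of_real l)" for w
  have Im_pos: "0 < Im (w + of_real d * \<i>)" if "- d < Im w" for w using that by simp
  note G_bounds = cayley_bounds[OF Re[OF Im_pos] l]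
  have holG: "G holomorphic_on {w. - d < Im w}"
  proof -
    have "(F \<circ> (\<lambda>w. w + of_real d * \<i>)) holomorphic_on {w. - d < Im w}"
      by (rule holomorphic_on_compose_gen[OF _ hol]) (auto intro!: holomorphic_intros)
    then have "(\<lambda>w. F (w + of_real d * \<i>)) holomorphic_on {w. - d < Im w}"
      by (simp add: o_def)
    then show ?thesis
      unfolding G_def using G_bounds(1) by (intro holomorphic_intros) auto
  qed
  have G1: "norm (G w) \<le> 1" if "- d < Im w" for w
    unfolding G_def using G_bounds(2)[OF that] .
  define u where "u t = Re (G (of_real t))" for t
  have u0: "0 \<le> u t" for t using d G_bounds(3)[of "of_real t"] by (simp add: u_def G_def)
  have contG: "continuous_on UNIV (\<lambda>t. G (of_real t))"
    by (rule continuous_on_compose2[OF holomorphic_on_imp_continuous_on[OF holG]])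
       (use d in \<open>auto intro!: continuous_intros\<close>)
  have contu: "continuous_on S u" for S
    unfolding u_def using continuous_on_subset[OF contG subset_UNIV] by (intro continuous_intros)
  have mu[measurable]: "u \<in> borel_measurable borel"
    by (intro borel_measurable_continuous_onI contu)
  define \<nu> where "\<nu> = density lborel (\<lambda>t. ennreal (u t))"
  have sets\<nu>: "sets \<nu> = sets borel" by (simp add: \<nu>_def)
  note [measurable_cong] = sets\<nu>
  have P: "\<bar>integral {-R..R} (\<lambda>t. y * u t / ((t - x)\<^sup>2 + y\<^sup>2)) - pi * Re (G (Complex x y))\<bar> \<le> 16 * y / R"
    if "0 < y" "2 * norm (Complex x y) < R" for x y R
    unfolding u_def by (rule poisson_half_plane_estimate[OF holG d G1 that])
  have contk: "continuous_on S (\<lambda>t. y * u t / ((t - x)\<^sup>2 + y\<^sup>2))" if "0 < y" for S x y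
    using that contu by (intro continuous_intros) (auto simp: add_nonneg_eq_0_iff)
  have lim0: "((\<lambda>R. a + 16 * y / R) \<longlongrightarrow> a) at_top" for a y :: real
    by real_asymp
  have large: "eventually (\<lambda>R. 2 * norm z < R) at_top" for z :: complex
    by (rule eventually_gt_at_top)
  have upper: "pi * Re (G (Complex x y)) \<le> b"
    if y: "0 < y" and b: "(\<integral>\<^sup>+ t. ennreal (y / ((t - x)\<^sup>2 + y\<^sup>2)) \<partial>\<nu>) \<le> ennreal b" and "0 \<le> b" for x y b
  proof (rule tendsto_lowerbound[OF lim0])
    show "eventually (\<lambda>R. pi * Re (G (Complex x y)) \<le> b + 16 * y / R) at_top"
      using large[of "Complex x y"]
    proof eventually_elim
      case (elim R)
      define k where "k t = y * u t / ((t - x)\<^sup>2 + y\<^sup>2)" for t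
      have k0: "0 \<le> k t" for t using y u0 by (simp add: k_def)
      have kb[measurable]: "k \<in> borel_measurable borel" unfolding k_def by measurable
      have "k integrable_on {-R..R}"
        unfolding k_def by (intro integrable_continuous_real contk y)
      then have "(k has_integral integral {-R..R} k) {-R..R}" by blast
      then have "(\<integral>\<^sup>+ t. ennreal (k t) * indicator {-R..R} t \<partial>lborel) = ennreal (integral {-R..R} k)"
        by (intro nn_integral_has_integral_lebesgue' k0) 
      moreover have "(\<integral>\<^sup>+ t. ennreal (k t) * indicator {-R..R} t \<partial>lborel) \<le> (\<integral>\<^sup>+ t. ennreal (k t) \<partial>lborel)"
        by (intro nn_integral_mono) (simp split: split_indicator)
      ultimately have "ennreal (integral {-R..R} k) \<le> (\<integral>\<^sup>+ t. ennreal (k t) \<partial>lborel)"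
        by simp
      also have "\<dots> = (\<integral>\<^sup>+ t. ennreal (y / ((t - x)\<^sup>2 + y\<^sup>2)) \<partial>\<nu>)"
        unfolding \<nu>_def using y u0
        by (subst nn_integral_density) (auto simp: k_def ennreal_mult[symmetric] mult.commute intro!: nn_integral_cong)
      also note b
      finally have "integral {-R..R} k \<le> b" using \<open>0 \<le> b\<close> by (simp add: ennreal_le_iff)
      then show ?case using P[OF y elim] unfolding k_def by linarith
    qed
  qed simp
  \<comment> \<open>Evaluate the Poisson integral at the point \<open>i A\<close>: there the kernel is at least \<open>1 / (2 A)\<close>
    on \<open>[-A, A]\<close>, whereas \<open>F\<close> is at most \<open>m / A\<close>.\<close>
  have mass_A: "integral {-A..A} u \<le> 2 * pi * m / l" if A: "0 < A" for A
  proof -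
    define k where "k t = A * u t / ((t - 0)\<^sup>2 + A\<^sup>2)" for t
    have k0: "0 \<le> k t" for t using A u0 by (simp add: k_def)
    have "integral {-A..A} u \<le> 2 * A * (pi * Re (G (Complex 0 A)))"
    proof (rule tendsto_lowerbound)
      show "((\<lambda>R. 2 * A * (pi * Re (G (Complex 0 A)) + 16 * A / R)) \<longlongrightarrow> 2 * A * (pi * Re (G (Complex 0 A)))) at_top"
        by (intro tendsto_mult tendsto_const lim0)
      show "eventually (\<lambda>R. integral {-A..A} u \<le> 2 * A * (pi * Re (G (Complex 0 A)) + 16 * A / R)) at_top"
        using large[of "Complex 0 A"]
      proof eventually_elim
        case (elim R)
        have RA: "A \<le> R" using elim A by (simp add: cmod_def)
        have ik: "k integrable_on {a..b}" for a b
          unfolding k_def by (intro integrable_continuous_real contk A)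
        have "integral {-A..A} u \<le> integral {-A..A} (\<lambda>t. 2 * A * k t)"
        proof (rule integral_le)
          show "u integrable_on {-A..A}" by (intro integrable_continuous_real contu)
          show "(\<lambda>t. 2 * A * k t) integrable_on {-A..A}" 
            using integrable_cmul[OF ik, of "2 * A" "-A" A] by simp
          fix t assume t: "t \<in> {-A..A}"
          have "t\<^sup>2 \<le> A\<^sup>2" using t by (auto intro!: abs_le_square_iff[THEN iffD1])
          then have "u t * (t\<^sup>2 + A\<^sup>2) \<le> u t * (2 * A\<^sup>2)"
            using u0 by (intro mult_left_mono) auto
          then show "u t \<le> 2 * A * k t"
            using A by (simp add: k_def pos_le_divide_eq add_nonneg_pos power2_eq_square mult_ac)
        qed
        also have "\<dots> = 2 * A * integral {-A..A} k" by simp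
        also have "\<dots> \<le> 2 * A * integral {-R..R} k"
          using A RA k0 ik by (intro mult_left_mono integral_subset_le) auto
        also have "\<dots> \<le> 2 * A * (pi * Re (G (Complex 0 A)) + 16 * A / R)"
          using P[OF A elim] A unfolding k_def by (intro mult_left_mono) auto
        finally show ?case .
      qed
    qed simp
    also have "\<dots> \<le> 2 * A * (pi * (m / A / l))"
    proof -
      have "Re (G (Complex 0 A)) \<le> norm (F (Complex 0 A + of_real d * \<i>)) / l"
        unfolding G_def using A d by (intro G_bounds(5)) simp
      also have "\<dots> \<le> (m / (A + d)) / l"
        using decay[of "Complex 0 A + of_real d * \<i>"] A d l by (intro divide_right_mono) auto
      also have "\<dots> \<le> (m / A) / l"
        using A d l m by (intro divide_right_mono divide_left_mono) auto
      finally show ?thesis using A by (intro mult_left_mono) auto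
    qed
    also have "\<dots> = 2 * pi * m / l" using A by (simp add: field_simps)
    finally show ?thesis .
  qed
  have mass: "emeasure \<nu> UNIV \<le> ennreal (2 * pi * m / l)"
  proof -
    have "(\<Union>n::nat. {- real (Suc n)..real (Suc n)}) = UNIV"
    proof (intro set_eqI iffI UNIV_I)
      fix x :: real
      obtain n where "\<bar>x\<bar> \<le> real n" using real_arch_simple by blast
      then show "x \<in> (\<Union>n::nat. {- real (Suc n)..real (Suc n)})" by (intro UN_I[of n]) auto
    qed
    then have "emeasure \<nu> UNIV = emeasure \<nu> (\<Union>n::nat. {- real (Suc n)..real (Suc n)})" by simp
    also have "\<dots> = (SUP n::nat. emeasure \<nu> {- real (Suc n)..real (Suc n)})"
      by (intro SUP_emeasure_incseq[symmetric]) (auto simp: sets\<nu> incseq_def)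
    also have "\<dots> \<le> ennreal (2 * pi * m / l)"
    proof (rule SUP_least)
      fix n :: nat
      let ?A = "real (Suc n)"
      have "emeasure \<nu> {-?A..?A} = (\<integral>\<^sup>+ t. ennreal (u t) * indicator {-?A..?A} t \<partial>lborel)"
        unfolding \<nu>_def by (subst emeasure_density) auto
      also have "\<dots> = ennreal (integral {-?A..?A} u)"
        by (intro nn_integral_has_integral_lebesgue' u0 integrable_integral integrable_continuous_real contu)
      also have "\<dots> \<le> ennreal (2 * pi * m / l)"
        by (intro ennreal_leI mass_A) simp
      finally show "emeasure \<nu> {-?A..?A} \<le> ennreal (2 * pi * m / l)" .
    qed
    finally show ?thesis .
  qed
  \<comment> \<open>With density below \<open>1/8\<close> on all intervals the Poisson integral would be at most \<open>1 < \<pi>/2\<close>.\<close>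
  have dense: "\<exists>r>0. ennreal (1/8 * r) \<le> emeasure \<nu> (ball x r)"
    if x: "x \<in> {x. \<exists>y>d. l < norm (F (Complex x y))}" for x
  proof (rule ccontr)
    assume no: "\<not> (\<exists>r>0. ennreal (1/8 * r) \<le> emeasure \<nu> (ball x r))"
    obtain y where y: "d < y" "l < norm (F (Complex x y))" using x by blast
    have "(\<integral>\<^sup>+ t. ennreal ((y - d) / ((t - x)\<^sup>2 + (y - d)\<^sup>2)) \<partial>\<nu>) \<le> ennreal (8 * (1/8))"
    proof (rule poisson_integral_le)
      fix r :: real assume "0 < r"
      with no have "\<not> ennreal (1/8 * r) \<le> emeasure \<nu> (ball x r)" by blast
      then show "emeasure \<nu> (ball x r) \<le> ennreal (1/8 * r)" by simp
    qed (use y sets\<nu> in auto)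
    then have "pi * Re (G (Complex x (y - d))) \<le> 1"
      using y by (intro upper) auto
    moreover have "1/2 \<le> Re (G (Complex x (y - d)))"
    proof -
      have e: "Complex x (y - d) + of_real d * \<i> = Complex x y" by (simp add: complex_eq_iff)
      have "1/2 \<le> Re (F (Complex x y) / (F (Complex x y) + of_real l))"
        using y d l by (intro cayley_bounds(4) Re) auto
      then show ?thesis by (simp add: G_def e)
    qed
    then have "pi * (1/2) \<le> pi * Re (G (Complex x (y - d)))" by (intro mult_left_mono) auto
    ultimately show False using pi_gt3 by simp
  qed
  have "0 \<le> 2 * pi * m / l" using m l by simp
  with dense have "\<exists>B\<in>sets borel. {x. \<exists>y>d. l < norm (F (Complex x y))} \<subseteq> B \<and>
      emeasure lborel B \<le> ennreal (10 * (2 * pi * m / l) / (1/8))"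
    by (intro vitali_weak_type[OF sets\<nu> mass]) auto
  moreover have "10 * (2 * pi * m / l) / (1/8) = 160 * pi * m / l" by simp
  ultimately show ?thesis by (simp only:)
qed

text \<open>
  The bound of the preceding lemma does not depend on the height \<open>d\<close>, and the exceptional sets increase
  to the full one as \<open>d\<close> decreases to \<open>0\<close>. They are open, hence measurable.
\<close>

lemma weak_type_half_plane:
  fixes F :: "complex \<Rightarrow> complex"
  assumes hol: "F holomorphic_on {z. 0 < Im z}"
    and Re: "\<And>z. 0 < Im z \<Longrightarrow> 0 \<le> Re (F z)"
    and decay: "\<And>z. 0 < Im z \<Longrightarrow> norm (F z) \<le> m / Im z"
    and l: "0 < l"
  shows "\<exists>B\<in>sets borel. emeasure lborel B \<le> ennreal (160 * pi * m / l) \<and>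
           (\<forall>x. x \<notin> B \<longrightarrow> (\<forall>y>0. norm (F (Complex x y)) \<le> l))"
proof -
  define E where "E d = {x. \<exists>y>d. l < norm (F (Complex x y))}" for d
  have E_mono: "E a \<subseteq> E b" if "b \<le> a" for a b
    using le_less_trans[OF that] by (auto simp: E_def)
  have open_E: "open (E d)" if "0 \<le> d" for d
  proof -
    have "E d = (\<Union>y\<in>{d<..}. {x. l < norm (F (Complex x y))})" by (auto simp: E_def)
    moreover have "open {x. l < norm (F (Complex x y))}" if "d < y" for y
    proof -
      have "continuous_on UNIV (\<lambda>x. Complex x y)"
        by (simp only: Complex_eq) (intro continuous_intros)
      then have "continuous_on UNIV (\<lambda>x. F (Complex x y))"
        by (rule continuous_on_compose2[OF holomorphic_on_imp_continuous_on[OF hol]])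
           (use \<open>0 \<le> d\<close> that in auto)
      then show ?thesis
        by (intro open_Collect_less continuous_on_const continuous_on_norm)
    qed
    ultimately show ?thesis by auto
  qed
  have le: "emeasure lborel (E d) \<le> ennreal (160 * pi * m / l)" if d: "0 < d" for d
  proof -
    obtain B where B: "B \<in> sets borel" "E d \<subseteq> B" "emeasure lborel B \<le> ennreal (160 * pi * m / l)"
      using weak_type_above_height[of F m l d, folded E_def] hol Re decay l d by auto
    have "emeasure lborel (E d) \<le> emeasure lborel B"
      using B by (intro emeasure_mono) auto
    then show ?thesis using B(3) by (rule order_trans)
  qed
  have U: "E 0 = (\<Union>n. E (inverse (real (Suc n))))"
  proof
    show "E 0 \<subseteq> (\<Union>n. E (inverse (real (Suc n))))"
    proof
      fix x assume "x \<in> E 0"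
      then obtain y where "0 < y" "l < norm (F (Complex x y))" by (auto simp: E_def)
      moreover then obtain n where "inverse (real (Suc n)) < y" using reals_Archimedean by blast
      ultimately show "x \<in> (\<Union>n. E (inverse (real (Suc n))))" by (auto simp: E_def simp del: of_nat_Suc)
    qed
    have "E (inverse (real (Suc n))) \<subseteq> E 0" for n
      by (intro E_mono) simp
    then show "(\<Union>n. E (inverse (real (Suc n)))) \<subseteq> E 0" by blast
  qed
  have "emeasure lborel (E 0) = (SUP n. emeasure lborel (E (inverse (real (Suc n)))))"
    unfolding U
  proof (intro SUP_emeasure_incseq[symmetric])
    show "range (\<lambda>n. E (inverse (real (Suc n)))) \<subseteq> sets lborel" using open_E by auto
    have "inverse (real (Suc n)) \<le> inverse (real (Suc m))" if "m \<le> n" for m n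
      using that by (intro le_imp_inverse_le) auto
    then show "incseq (\<lambda>n. E (inverse (real (Suc n))))"
      unfolding incseq_def by (auto intro!: E_mono)
  qed
  also have "\<dots> \<le> ennreal (160 * pi * m / l)"
    by (intro SUP_least le) simp
  finally have "emeasure lborel (E 0) \<le> ennreal (160 * pi * m / l)" .
  moreover have "E 0 \<in> sets borel" using open_E by simp
  moreover have "\<forall>x. x \<notin> E 0 \<longrightarrow> (\<forall>y>0. norm (F (Complex x y)) \<le> l)"
    unfolding E_def mem_Collect_eq by (meson not_le)
  ultimately show ?thesis by (intro bexI[of _ "E 0"]) simp_all
qed

section \<open>Cauchy transforms and truncated Hilbert transforms\<close>

text \<open>
  The factor \<open>\<i>\<close> is chosen so that a nonnegative function has a transform with nonnegative real part,
  namely its Poisson integral; the imaginary part is the conjugate Poisson integral.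
\<close>

definition cauchy_transform :: "(real \<Rightarrow> real) \<Rightarrow> complex \<Rightarrow> complex" where
  "cauchy_transform g z = (LINT t|mu. \<i> * of_real (g t) / (z - of_real t))"

lemma Im_le_norm_diff_of_real: "Im z \<le> norm (z - of_real t)"
  using abs_Im_le_cmod[of "z - of_real t"] by simp

text \<open>
  The Cauchy kernel and the kernels occurring in its difference quotients are all bounded.
\<close>

lemma integrable_times_bounded_kernel:
  fixes k :: "real \<Rightarrow> complex" and g :: "real \<Rightarrow> real"
  assumes g: "integrable mu g" and [measurable]: "k \<in> borel_measurable borel"
    and "\<And>t. norm (k t) \<le> C"
  shows "integrable mu (\<lambda>t. \<i> * of_real (g t) * k t)"
proof (rule Bochner_Integration.integrable_bound)
  show "integrable mu (\<lambda>t. C * g t)" using g by simp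
  have [measurable]: "g \<in> borel_measurable mu" using g by simp
  have [measurable]: "k \<in> borel_measurable mu" by (simp add: measurable_restrict_space1)
  show "(\<lambda>t. \<i> * of_real (g t) * k t) \<in> borel_measurable mu" by measurable
  show "AE t in mu. norm (\<i> * of_real (g t) * k t) \<le> norm (C * g t)"
  proof (rule AE_I2)
    fix t
    have "0 \<le> C" using assms(3)[of t] norm_ge_zero order_trans by blast
    then show "norm (\<i> * of_real (g t) * k t) \<le> norm (C * g t)"
      using mult_right_mono[OF assms(3)[of t], of "\<bar>g t\<bar>"] by (simp add: norm_mult abs_mult mult.commute)
  qed
qed

lemma norm_cauchy_kernel_le:
  assumes "0 < Im z"
  shows "norm (1 / (z - of_real t)) \<le> 1 / Im z"
  using assms Im_le_norm_diff_of_real[of z t] by (simp add: norm_divide frac_le)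

lemma integrable_cauchy:
  assumes "integrable mu g" "0 < Im z"
  shows "integrable mu (\<lambda>t. \<i> * of_real (g t) / (z - of_real t))"
proof -
  have "integrable mu (\<lambda>t. \<i> * of_real (g t) * (1 / (z - of_real t)))"
    by (rule integrable_times_bounded_kernel[OF assms(1) _ norm_cauchy_kernel_le[OF assms(2)]]) measurable
  then show ?thesis by simp
qed

text \<open>
  Differentiation under the integral sign, by the explicit remainder \<open>h / (w\<^sup>2 (w + h))\<close> of the
  difference quotient of \<open>1 / w\<close>, which is uniformly \<open>O(h)\<close> at positive distance from the real axis.
\<close>

lemma cauchy_transform_deriv:
  assumes g: "integrable mu g" and z: "0 < Im z"
  shows "(cauchy_transform g has_field_derivative
            (LINT t|mu. - \<i> * of_real (g t) / (z - of_real t)\<^sup>2)) (at z)"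
proof -
  define y where "y = Im z"
  have y: "0 < y" using z y_def by simp
  define D where "D = (LINT t|mu. - \<i> * of_real (g t) / (z - of_real t)\<^sup>2)"
  define C where "C = 2 / y ^ 3"
  have intD: "integrable mu (\<lambda>t. - \<i> * of_real (g t) / (z - of_real t)\<^sup>2)"
  proof -
    have "norm (- (1 / (z - of_real t))\<^sup>2) \<le> (1 / Im z)\<^sup>2" for t
      using power_mono[OF norm_cauchy_kernel_le[OF z, of t] norm_ge_zero, of 2]
      by (simp add: norm_power)
    from integrable_times_bounded_kernel[OF g _ this] show ?thesis by (simp add: power_divide)
  qed
  have bound: "norm ((cauchy_transform g (z + h) - cauchy_transform g z) / h - D)
       \<le> norm h * (C * (LINT t|mu. norm (g t)))" if h: "h \<noteq> 0" "norm h < y / 2" for h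
  proof -
    have zh: "y / 2 \<le> Im (z + h)" using h abs_Im_le_cmod[of h] y_def by simp
    then have zh0: "0 < Im (z + h)" using y by linarith
    have ne: "z - of_real t \<noteq> 0" "z + h - of_real t \<noteq> 0" for t
      using z zh0 by (auto simp: complex_eq_iff)
    have key: "(\<i> * of_real (g t) / (z + h - of_real t) - \<i> * of_real (g t) / (z - of_real t)) / h
        - (- \<i> * of_real (g t) / (z - of_real t)\<^sup>2)
        = \<i> * of_real (g t) * (h / ((z - of_real t)\<^sup>2 * (z + h - of_real t)))" for t
    proof -
      have "1 / (w + h) / h - 1 / w / h + 1 / w\<^sup>2 = h / (w\<^sup>2 * (w + h))"
        if "w \<noteq> 0" "w + h \<noteq> 0" for w
        using that h by (simp add: divide_simps power2_eq_square)
      from this[of "z - of_real t"] ne[of t]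
      have "\<i> * of_real (g t) * (1 / (z + h - of_real t) / h - 1 / (z - of_real t) / h + 1 / (z - of_real t)\<^sup>2)
        = \<i> * of_real (g t) * (h / ((z - of_real t)\<^sup>2 * (z + h - of_real t)))"
        by (simp add: algebra_simps)
      then show ?thesis by (simp add: algebra_simps diff_divide_distrib)
    qed
    have "(cauchy_transform g (z + h) - cauchy_transform g z) / h - D =
      (LINT t|mu. (\<i> * of_real (g t) / (z + h - of_real t) - \<i> * of_real (g t) / (z - of_real t)) / h
        - (- \<i> * of_real (g t) / (z - of_real t)\<^sup>2))"
      unfolding cauchy_transform_def D_def using integrable_cauchy[OF g] z zh0 intD by simp
    also have "\<dots> = (LINT t|mu. \<i> * of_real (g t) * (h / ((z - of_real t)\<^sup>2 * (z + h - of_real t))))"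
      by (simp only: key)
    also have "norm \<dots> \<le> (LINT t|mu. norm h * C * norm (g t))"
    proof (rule Bochner_Integration.integral_norm_bound_integral)
      have kb: "norm (h / ((z - of_real t)\<^sup>2 * (z + h - of_real t))) \<le> norm h * C" for t
      proof -
        have "y \<le> norm (z - of_real t)" "y / 2 \<le> norm (z + h - of_real t)"
          using Im_le_norm_diff_of_real[of z t] Im_le_norm_diff_of_real[of "z + h" t] zh
          by (auto simp: y_def)
        then have "y\<^sup>2 * (y / 2) \<le> (norm (z - of_real t))\<^sup>2 * norm (z + h - of_real t)"
          using y by (intro mult_mono power_mono) auto
        then have "norm h / ((norm (z - of_real t))\<^sup>2 * norm (z + h - of_real t)) \<le> norm h / (y\<^sup>2 * (y / 2))"
          using y ne[of t] by (intro divide_left_mono) auto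
        then show ?thesis by (simp add: C_def norm_divide norm_mult norm_power power3_eq_cube power2_eq_square)
      qed
      show "integrable mu (\<lambda>t. \<i> * of_real (g t) * (h / ((z - of_real t)\<^sup>2 * (z + h - of_real t))))"
        by (rule integrable_times_bounded_kernel[OF g _ kb]) measurable
      show "integrable mu (\<lambda>t. norm h * C * norm (g t))" using g by simp
      show "norm (\<i> * of_real (g t) * (h / ((z - of_real t)\<^sup>2 * (z + h - of_real t)))) \<le> norm h * C * norm (g t)" for t
        using mult_right_mono[OF kb[of t], of "\<bar>g t\<bar>"] by (simp add: norm_mult norm_divide mult.commute)
    qed
    also have "\<dots> = norm h * (C * (LINT t|mu. norm (g t)))" by simp
    finally show ?thesis .
  qed
  have "((\<lambda>h. (cauchy_transform g (z + h) - cauchy_transform g z) / h - D) \<longlongrightarrow> 0) (at 0)"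
  proof (rule Lim_null_comparison)
    show "eventually (\<lambda>h. norm ((cauchy_transform g (z + h) - cauchy_transform g z) / h - D)
       \<le> norm h * (C * (LINT t|mu. norm (g t)))) (at 0)"
      unfolding eventually_at using bound y by (intro exI[of _ "y/2"]) (auto simp: dist_norm)
    show "((\<lambda>h. norm h * (C * (LINT t|mu. norm (g t)))) \<longlongrightarrow> 0) (at (0::complex))"
      by (auto intro!: tendsto_eq_intros)
  qed
  then show ?thesis
    unfolding DERIV_def D_def[symmetric] by (simp add: LIM_zero_iff)
qed

lemma cauchy_transform_holomorphic:
  assumes "integrable mu g"
  shows "cauchy_transform g holomorphic_on {z. 0 < Im z}"
  unfolding holomorphic_on_def field_differentiable_def
proof (intro ballI exI)
  fix z :: complex assume "z \<in> {z. 0 < Im z}"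
  then show "(cauchy_transform g has_field_derivative
      (LINT t|mu. - \<i> * of_real (g t) / (z - of_real t)\<^sup>2)) (at z within {z. 0 < Im z})"
    by (intro has_field_derivative_at_within[OF cauchy_transform_deriv[OF assms]]) simp
qed

lemma cauchy_kernel_Complex:
  assumes "0 < e"
  shows "\<i> / (Complex x e - of_real t)
           = Complex (e / ((t - x)\<^sup>2 + e\<^sup>2)) ((x - t) / ((t - x)\<^sup>2 + e\<^sup>2))"
  using assms
  by (simp add: complex_eq_iff Re_divide Im_divide power2_commute[of t x])

lemma Re_Im_cauchy_transform:
  assumes g: "integrable mu g" and e: "0 < e"
  shows "Re (cauchy_transform g (Complex x e)) = (LINT t|mu. g t * (e / ((t - x)\<^sup>2 + e\<^sup>2)))"
    and "Im (cauchy_transform g (Complex x e)) = (LINT t|mu. g t * ((x - t) / ((t - x)\<^sup>2 + e\<^sup>2)))"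
    and "integrable mu (\<lambda>t. g t * (e / ((t - x)\<^sup>2 + e\<^sup>2)))"
    and "integrable mu (\<lambda>t. g t * ((x - t) / ((t - x)\<^sup>2 + e\<^sup>2)))"
proof -
  have int: "integrable mu (\<lambda>t. \<i> * of_real (g t) / (Complex x e - of_real t))"
    using integrable_cauchy[OF g, of "Complex x e"] e by simp
  have eq: "\<i> * of_real (g t) / (Complex x e - of_real t) =
     Complex (g t * (e / ((t - x)\<^sup>2 + e\<^sup>2))) (g t * ((x - t) / ((t - x)\<^sup>2 + e\<^sup>2)))" for t
  proof -
    have "\<i> * of_real (g t) / (Complex x e - of_real t) = of_real (g t) * (\<i> / (Complex x e - of_real t))"
      by simp
    also have "\<dots> = Complex (g t * (e / ((t - x)\<^sup>2 + e\<^sup>2))) (g t * ((x - t) / ((t - x)\<^sup>2 + e\<^sup>2)))"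
      unfolding cauchy_kernel_Complex[OF e] by (simp add: complex_eq_iff)
    finally show ?thesis .
  qed
  show "Re (cauchy_transform g (Complex x e)) = (LINT t|mu. g t * (e / ((t - x)\<^sup>2 + e\<^sup>2)))"
    using integral_Re[OF int] by (simp add: cauchy_transform_def eq)
  show "Im (cauchy_transform g (Complex x e)) = (LINT t|mu. g t * ((x - t) / ((t - x)\<^sup>2 + e\<^sup>2)))"
    using integral_Im[OF int] by (simp add: cauchy_transform_def eq)
  show "integrable mu (\<lambda>t. g t * (e / ((t - x)\<^sup>2 + e\<^sup>2)))"
    using integrable_Re[OF int] by (simp add: eq)
  show "integrable mu (\<lambda>t. g t * ((x - t) / ((t - x)\<^sup>2 + e\<^sup>2)))"
    using integrable_Im[OF int] by (simp add: eq)
qed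

lemma norm_cauchy_transform_le:
  assumes "integrable mu g" "0 < Im z"
  shows "norm (cauchy_transform g z) \<le> (LINT t|mu. norm (g t)) / Im z"
proof -
  have "norm (cauchy_transform g z) \<le> (LINT t|mu. norm (g t) / Im z)"
    unfolding cauchy_transform_def
  proof (rule Bochner_Integration.integral_norm_bound_integral)
    show "integrable mu (\<lambda>t. norm (g t) / Im z)" using assms by simp
    show "norm (\<i> * of_real (g t) / (z - of_real t)) \<le> norm (g t) / Im z" for t
      using mult_left_mono[OF norm_cauchy_kernel_le[OF assms(2), of t], of "\<bar>g t\<bar>"]
      by (simp add: norm_mult norm_divide)
  qed (use integrable_cauchy assms in auto)
  then show ?thesis by simp
qed

definition truncated_kernel :: "real \<Rightarrow> real \<Rightarrow> real \<Rightarrow> real" where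
  "truncated_kernel e t x = (if e < \<bar>x - t\<bar> then 1 / (x - t) else 0)"

lemma truncated_kernel_measurable [measurable]:
  "truncated_kernel e t \<in> borel_measurable borel"
  unfolding truncated_kernel_def[abs_def] by measurable

lemma truncated_kernel_le: "0 < e \<Longrightarrow> \<bar>truncated_kernel e t x\<bar> \<le> 1 / e"
  by (auto simp: truncated_kernel_def frac_le)

lemma integrable_times_truncated_kernel:
  fixes f :: "real \<Rightarrow> 'b :: {real_normed_algebra_1, banach, second_countable_topology}"
  assumes f: "integrable mu f" and e: "0 < e"
  shows "integrable mu (\<lambda>x. f x * of_real (truncated_kernel e t x))"
proof (rule Bochner_Integration.integrable_bound)
  show "integrable mu (\<lambda>x. norm (f x) / e)" using f by simp
  have [measurable]: "f \<in> borel_measurable mu" using f by simp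
  have [measurable]: "truncated_kernel e t \<in> borel_measurable mu" by (simp add: measurable_restrict_space1)
  show "(\<lambda>x. f x * of_real (truncated_kernel e t x)) \<in> borel_measurable mu" by measurable
  show "AE x in mu. norm (f x * of_real (truncated_kernel e t x)) \<le> norm (norm (f x) / e)"
  proof (rule AE_I2)
    fix x
    have "norm (f x * of_real (truncated_kernel e t x)) \<le> norm (f x) * \<bar>truncated_kernel e t x\<bar>"
      by (metis norm_mult_ineq norm_of_real)
    also have "\<dots> \<le> norm (f x) * (1 / e)"
      by (intro mult_left_mono truncated_kernel_le e) auto
    finally show "norm (f x * of_real (truncated_kernel e t x)) \<le> norm (norm (f x) / e)"
      using e by simp
  qed
qed

lemma truncated_hilbert_eq:
  assumes f: "integrable mu f" and e: "0 < e"
  shows "truncated_hilbert e f t = of_real (1 / pi) * (LINT x|mu. f x * of_real (truncated_kernel e t x))"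
proof -
  have int: "integrable mu (\<lambda>x. indicator S x *\<^sub>R (f x / of_real (x - t)))"
    if S: "S \<in> sets borel" "\<And>x. x \<in> S \<Longrightarrow> e < \<bar>x - t\<bar>" for S
  proof -
    have "S \<inter> {-1<..<1} \<in> sets mu" using S by (simp add: sets_restrict_space_iff)
    then have "integrable mu (\<lambda>x. indicator (S \<inter> {-1<..<1}) x *\<^sub>R (f x * of_real (truncated_kernel e t x)))"
      by (rule integrable_mult_indicator[OF _ integrable_times_truncated_kernel[OF f e]])
    then show ?thesis
      by (rule Bochner_Integration.integrable_cong[OF refl, THEN iffD1, rotated])
         (use S(2) in \<open>auto simp: truncated_kernel_def indicator_def space_restrict_space\<close>)
  qed
  have "(LINT x:{-1<..<t - e}|mu. f x / of_real (x - t)) + (LINT x:{t + e<..<1}|mu. f x / of_real (x - t))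
     = (LINT x|mu. indicator {-1<..<t - e} x *\<^sub>R (f x / of_real (x - t)) + indicator {t + e<..<1} x *\<^sub>R (f x / of_real (x - t)))"
    unfolding set_lebesgue_integral_def
    by (intro Bochner_Integration.integral_add[symmetric] int) auto
  also have "\<dots> = (LINT x|mu. f x * of_real (truncated_kernel e t x))"
    by (intro Bochner_Integration.integral_cong refl)
       (use e in \<open>auto simp: truncated_kernel_def indicator_def space_restrict_space\<close>)
  finally show ?thesis by (simp add: truncated_hilbert_def)
qed

text \<open>
  Truncating at distance \<open>e\<close> and regularising at height \<open>e\<close> differ by at most the Poisson kernel at
  height \<open>e\<close>: inside the truncation the conjugate kernel has numerator at most \<open>e\<close>, and outside the
  difference is \<open>e / s\<close> times the Poisson kernel, with \<open>\<bar>s\<bar> > e\<close>.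
\<close>

lemma truncated_kernel_poisson:
  assumes e: "0 < e"
  shows "\<bar>truncated_kernel e t x + (t - x) / ((x - t)\<^sup>2 + e\<^sup>2)\<bar> \<le> e / ((x - t)\<^sup>2 + e\<^sup>2)"
proof -
  define s where "s = x - t"
  have den: "0 < s\<^sup>2 + e\<^sup>2" using e by (simp add: add_nonneg_pos)
  have ts: "t - x = - s" by (simp add: s_def)
  show ?thesis
  proof (cases "e < \<bar>s\<bar>")
    case False
    then have "\<bar>s / (s\<^sup>2 + e\<^sup>2)\<bar> \<le> e / (s\<^sup>2 + e\<^sup>2)"
      using den by (simp add: abs_divide divide_right_mono)
    then show ?thesis using False by (simp add: truncated_kernel_def ts flip: s_def)
  next
    case True
    have s0: "s \<noteq> 0" using True e by auto
    have "1 / s - s / (s\<^sup>2 + e\<^sup>2) = (e / s) * (e / (s\<^sup>2 + e\<^sup>2))"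
      using s0 den by (simp add: field_simps power2_eq_square)
    moreover have "\<bar>(e / s) * (e / (s\<^sup>2 + e\<^sup>2))\<bar> \<le> 1 * (e / (s\<^sup>2 + e\<^sup>2))"
    proof -
      have "\<bar>e / s\<bar> \<le> 1" using True e by (simp add: abs_divide)
      moreover have "0 \<le> e / (s\<^sup>2 + e\<^sup>2)" using den e by simp
      ultimately show ?thesis
        unfolding abs_mult by (intro mult_mono) auto
    qed
    ultimately show ?thesis using True by (simp add: truncated_kernel_def ts flip: s_def)
  qed
qed

text \<open>
  By the kernel comparison, \<open>\<pi>\<close> times the truncation is bounded by \<open>\<bar>Im F\<bar> + Re F\<close>; positivity of \<open>g\<close>
  turns the Poisson integral of \<open>\<bar>g\<bar>\<close> into \<open>Re F\<close>, and \<open>2 \<le> \<pi>\<close> absorbs the sum.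
\<close>

lemma norm_truncated_le_cauchy_transform:
  assumes g: "integrable mu g" "\<And>x. 0 \<le> g x" and e: "0 < e"
  shows "norm (truncated_hilbert e (\<lambda>x. of_real (g x)) t) \<le> norm (cauchy_transform g (Complex t e))"
proof -
  let ?F = "cauchy_transform g (Complex t e)"
  define I where "I = (LINT x|mu. g x * truncated_kernel e t x)"
  have int: "integrable mu (\<lambda>x. g x * truncated_kernel e t x)"
    using integrable_times_truncated_kernel[OF g(1) e, of t] by simp
  have "(LINT x|mu. of_real (g x) * of_real (truncated_kernel e t x)) = complex_of_real I"
    unfolding I_def by (simp only: of_real_mult[symmetric] integral_complex_of_real)
  then have trunc: "truncated_hilbert e (\<lambda>x. of_real (g x)) t = of_real (1 / pi * I)"
    using g e by (subst truncated_hilbert_eq) simp_all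
  note RI = Re_Im_cauchy_transform[OF g(1) e, of t]
  have "I + Im ?F = (LINT x|mu. g x * truncated_kernel e t x + g x * ((t - x) / ((x - t)\<^sup>2 + e\<^sup>2)))"
    unfolding I_def RI(2) using int RI(4) by (intro Bochner_Integration.integral_add[symmetric]) auto
  also have "\<dots> = (LINT x|mu. g x * (truncated_kernel e t x + (t - x) / ((x - t)\<^sup>2 + e\<^sup>2)))"
    by (simp only: distrib_left)
  also have "\<bar>\<dots>\<bar> \<le> (LINT x|mu. g x * (e / ((x - t)\<^sup>2 + e\<^sup>2)))"
    unfolding real_norm_def[symmetric]
  proof (rule Bochner_Integration.integral_norm_bound_integral)
    show "integrable mu (\<lambda>x. g x * (truncated_kernel e t x + (t - x) / ((x - t)\<^sup>2 + e\<^sup>2)))"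
      unfolding distrib_left using int RI(4) by simp
    show "integrable mu (\<lambda>x. g x * (e / ((x - t)\<^sup>2 + e\<^sup>2)))" by (rule RI(3))
    show "norm (g x * (truncated_kernel e t x + (t - x) / ((x - t)\<^sup>2 + e\<^sup>2))) \<le> g x * (e / ((x - t)\<^sup>2 + e\<^sup>2))" for x
      unfolding real_norm_def abs_mult abs_of_nonneg[OF g(2)]
      by (intro mult_left_mono truncated_kernel_poisson e g)
  qed
  also have "\<dots> = Re ?F" using RI(1) by simp
  finally have "\<bar>I\<bar> \<le> \<bar>Re ?F\<bar> + \<bar>Im ?F\<bar>" by linarith
  also have "\<dots> \<le> norm ?F + norm ?F" by (intro add_mono abs_Re_le_cmod abs_Im_le_cmod)
  finally have "\<bar>I\<bar> \<le> pi * norm ?F"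
    using pi_ge_two mult_right_mono[of 2 pi "norm ?F"] by simp
  then have "\<bar>1 / pi * I\<bar> \<le> norm ?F" by (simp add: field_simps abs_mult)
  then show ?thesis unfolding trunc by (simp only: norm_of_real)
qed

lemma weak_type_truncated_nonneg:
  assumes g: "integrable mu g" "\<And>x. 0 \<le> g x" and l: "0 < l"
  shows "\<exists>B\<in>sets borel. emeasure lborel B \<le> ennreal (160 * pi * (LINT x|mu. g x) / l) \<and>
           (\<forall>t. t \<notin> B \<longrightarrow> (\<forall>e>0. norm (truncated_hilbert e (\<lambda>x. of_real (g x)) t) \<le> l))"
proof -
  have "\<exists>B\<in>sets borel. emeasure lborel B \<le> ennreal (160 * pi * (LINT x|mu. g x) / l) \<and>
           (\<forall>t. t \<notin> B \<longrightarrow> (\<forall>y>0. norm (cauchy_transform g (Complex t y)) \<le> l))"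
  proof (rule weak_type_half_plane[OF cauchy_transform_holomorphic[OF g(1)] _ _ l])
    fix z :: complex assume z: "0 < Im z"
    obtain x y where xy: "z = Complex x y" "0 < y" using z by (cases z) auto
    show "0 \<le> Re (cauchy_transform g z)"
      unfolding xy(1) Re_Im_cauchy_transform(1)[OF g(1) xy(2)]
      using g xy by (intro Bochner_Integration.integral_nonneg mult_nonneg_nonneg) auto
    show "norm (cauchy_transform g z) \<le> (LINT x|mu. g x) / Im z"
      using norm_cauchy_transform_le[OF g(1) z] g(2) by simp
  qed
  then show ?thesis
    using norm_truncated_le_cauchy_transform[OF g] by (meson order_trans)
qed

lemma truncated_hilbert_add:
  assumes "integrable mu f" "integrable mu g" "0 < e"
  shows "truncated_hilbert e (\<lambda>x. f x + g x) t = truncated_hilbert e f t + truncated_hilbert e g t"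
  using assms by (simp add: truncated_hilbert_eq distrib_right integrable_times_truncated_kernel distrib_left)

lemma truncated_hilbert_scale:
  assumes "integrable mu f" "0 < e"
  shows "truncated_hilbert e (\<lambda>x. c * f x) t = c * truncated_hilbert e f t"
  using assms by (simp add: truncated_hilbert_eq mult.assoc integrable_times_truncated_kernel)

text \<open>
  The maximal inequality. The function is split into the positive and negative parts of its real and
  imaginary parts, each treated at level \<open>l / 4\<close>, which multiplies the constant \<open>160 \<pi>\<close> by
  \<open>16\<close>. Uniformity in \<open>e\<close> is what later gives convergence almost everywhere.
\<close>

lemma weak_type_truncated:
  assumes f: "integrable mu f" and l: "0 < l"
  shows "\<exists>B\<in>sets borel. emeasure lborel B \<le> ennreal (2560 * pi * (LINT x|mu. norm (f x)) / l) \<and>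
           (\<forall>t. t \<notin> B \<longrightarrow> (\<forall>e>0. norm (truncated_hilbert e f t) \<le> l))"
proof -
  define part where "part j x = (if j = 0 then max 0 (Re (f x)) else if j = 1 then max 0 (- Re (f x))
       else if j = 2 then max 0 (Im (f x)) else max 0 (- Im (f x)))" for j :: nat and x
  define co :: "nat \<Rightarrow> complex" where "co j = (if j = 0 then 1 else if j = 1 then - 1 else if j = 2 then \<i> else - \<i>)" for j
  have part0: "0 \<le> part j x" for j x by (simp add: part_def)
  have intp: "integrable mu (part j)" for j
    unfolding part_def[abs_def] using f by (cases "j = 0"; cases "j = 1"; cases "j = 2") auto
  have le: "part j x \<le> norm (f x)" for j x
    using abs_Re_le_cmod[of "f x"] abs_Im_le_cmod[of "f x"] by (auto simp: part_def)
  have split: "f = (\<lambda>x. co 0 * of_real (part 0 x) + (co 1 * of_real (part 1 x) + (co 2 * of_real (part 2 x) + co 3 * of_real (part 3 x))))"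
    by (rule ext) (auto simp: co_def part_def complex_eq_iff max_def)
  have l4: "0 < l / 4" using l by simp
  have "\<exists>B\<in>sets borel. emeasure lborel B \<le> ennreal (160 * pi * (LINT x|mu. part j x) / (l/4)) \<and>
           (\<forall>t. t \<notin> B \<longrightarrow> (\<forall>e>0. norm (truncated_hilbert e (\<lambda>x. of_real (part j x)) t) \<le> l/4))" for j
    by (rule weak_type_truncated_nonneg[OF intp part0 l4])
  then obtain B where B: "\<And>j. B j \<in> sets borel"
      "\<And>j. emeasure lborel (B j) \<le> ennreal (160 * pi * (LINT x|mu. part j x) / (l/4))"
      "\<And>j t e. t \<notin> B j \<Longrightarrow> 0 < e \<Longrightarrow> norm (truncated_hilbert e (\<lambda>x. of_real (part j x)) t) \<le> l/4"
    by metis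
  define m where "m = (LINT x|mu. norm (f x))"
  have m: "0 \<le> m" unfolding m_def by simp
  have Bm: "emeasure lborel (B j) \<le> ennreal (160 * pi * m / (l/4))" for j
  proof (rule order_trans[OF B(2)], rule ennreal_leI)
    have "(LINT x|mu. part j x) \<le> m"
      unfolding m_def using intp f le by (intro integral_mono) auto
    then show "160 * pi * (LINT x|mu. part j x) / (l/4) \<le> 160 * pi * m / (l/4)"
      using l by (intro divide_right_mono mult_left_mono) auto
  qed
  have "emeasure lborel (\<Union>j<4. B j) \<le> (\<Sum>j<4. emeasure lborel (B j))"
    using B(1) by (intro emeasure_subadditive_finite) auto
  also have "\<dots> \<le> (\<Sum>j<4::nat. ennreal (160 * pi * m / (l/4)))"
    by (intro sum_mono Bm)
  also have "\<dots> = ennreal (\<Sum>j<4::nat. 160 * pi * m / (l/4))"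
    using m l by (intro sum_ennreal) auto
  also have "(\<Sum>j<4::nat. 160 * pi * m / (l/4)) = 2560 * pi * m / l" by simp
  finally have "emeasure lborel (\<Union>j<4. B j) \<le> ennreal (2560 * pi * m / l)" .
  moreover have "norm (truncated_hilbert e f t) \<le> l" if t: "t \<notin> (\<Union>j<4. B j)" and e: "0 < e" for t e
  proof -
    define T where "T j = co j * truncated_hilbert e (\<lambda>x. of_real (part j x)) t" for j
    have T: "norm (T j) \<le> l / 4" if "j < 4" for j
      using B(3)[of t j e] t e that by (auto simp: T_def norm_mult co_def)
    have intc: "integrable mu (\<lambda>x. complex_of_real (part j x))" for j using intp by simp
    have "truncated_hilbert e f t = T 0 + (T 1 + (T 2 + T 3))"
      by (subst split) (simp add: truncated_hilbert_add truncated_hilbert_scale T_def e intc)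
    also have "norm \<dots> \<le> norm (T 0) + (norm (T 1) + (norm (T 2) + norm (T 3)))"
      by (intro norm_triangle_le add_mono order_refl norm_triangle_ineq)
    also have "\<dots> \<le> l / 4 + (l / 4 + (l / 4 + l / 4))"
      by (intro add_mono T) auto
    finally show ?thesis by simp
  qed
  moreover have "(\<Union>j<4. B j) \<in> sets borel" using B(1) by auto
  ultimately show ?thesis unfolding m_def by blast
qed

section \<open>Almost everywhere existence of the principal value\<close>

lemma finite_measure_mu: "finite_measure mu"
  by (intro finite_measureI) (simp add: emeasure_restrict_space space_restrict_space)

interpretation mu: finite_measure mu
  by (rule finite_measure_mu)

lemma AE_mu_iff: "(AE t in mu. P t) \<longleftrightarrow> (AE t in lborel. t \<in> {-1<..<1} \<longrightarrow> P t)"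
  by (rule AE_restrict_space_iff) simp

definition pv_exists :: "(real \<Rightarrow> complex) \<Rightarrow> real \<Rightarrow> bool" where
  "pv_exists f t \<longleftrightarrow> (\<exists>l. ((\<lambda>e. truncated_hilbert e f t) \<longlongrightarrow> l) (at_right 0))"

lemma finite_hilbert_limit:
  "pv_exists f t \<Longrightarrow> ((\<lambda>e. truncated_hilbert e f t) \<longlongrightarrow> finite_hilbert f t) (at_right 0)"
  unfolding pv_exists_def finite_hilbert_def
  by (auto simp: tendsto_Lim trivial_limit_at_right_real)

lemma finite_hilbert_eqI:
  "((\<lambda>e. truncated_hilbert e f t) \<longlongrightarrow> l) (at_right 0) \<Longrightarrow> finite_hilbert f t = l"
  using tendsto_unique[OF trivial_limit_at_right_real finite_hilbert_limit] pv_exists_def by blast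

lemma pv_add:
  assumes "integrable mu f" "integrable mu g" "pv_exists f t" "pv_exists g t"
  shows "pv_exists (\<lambda>x. f x + g x) t"
    and "finite_hilbert (\<lambda>x. f x + g x) t = finite_hilbert f t + finite_hilbert g t"
proof -
  have "((\<lambda>e. truncated_hilbert e f t + truncated_hilbert e g t) \<longlongrightarrow> finite_hilbert f t + finite_hilbert g t) (at_right 0)"
    by (intro tendsto_add finite_hilbert_limit assms)
  then have "((\<lambda>e. truncated_hilbert e (\<lambda>x. f x + g x) t) \<longlongrightarrow> finite_hilbert f t + finite_hilbert g t) (at_right 0)"
    by (rule Lim_transform_eventually)
       (auto simp: eventually_at_right_less truncated_hilbert_add assms intro: eventually_mono[OF eventually_at_right_less])
  then show "pv_exists (\<lambda>x. f x + g x) t" "finite_hilbert (\<lambda>x. f x + g x) t = finite_hilbert f t + finite_hilbert g t"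
    by (auto simp: pv_exists_def finite_hilbert_eqI)
qed

lemma pv_scale:
  assumes "integrable mu f" "pv_exists f t"
  shows "pv_exists (\<lambda>x. c * f x) t"
    and "finite_hilbert (\<lambda>x. c * f x) t = c * finite_hilbert f t"
proof -
  have "((\<lambda>e. c * truncated_hilbert e f t) \<longlongrightarrow> c * finite_hilbert f t) (at_right 0)"
    by (intro tendsto_mult tendsto_const finite_hilbert_limit assms)
  then have "((\<lambda>e. truncated_hilbert e (\<lambda>x. c * f x) t) \<longlongrightarrow> c * finite_hilbert f t) (at_right 0)"
    by (rule Lim_transform_eventually)
       (auto simp: truncated_hilbert_scale assms intro: eventually_mono[OF eventually_at_right_less])
  then show "pv_exists (\<lambda>x. c * f x) t" "finite_hilbert (\<lambda>x. c * f x) t = c * finite_hilbert f t"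
    by (auto simp: pv_exists_def finite_hilbert_eqI)
qed

lemma AE_pv_add:
  assumes "integrable mu f" "integrable mu g"
    and "AE t in mu. pv_exists f t" "AE t in mu. pv_exists g t"
  shows "AE t in mu. pv_exists (\<lambda>x. f x + g x) t"
  by (rule AE_mp[OF assms(3)], rule AE_mp[OF assms(4)]) (auto intro!: AE_I2 pv_add assms)

lemma AE_pv_scale:
  assumes "integrable mu f" "AE t in mu. pv_exists f t"
  shows "AE t in mu. pv_exists (\<lambda>x. c * f x) t"
  by (rule AE_mp[OF assms(2)]) (auto intro!: AE_I2 pv_scale assms)

text \<open>
  Existence of the limit as a Cauchy condition with countable quantifiers in front; this form serves
  both the approximation argument and, once the radii are restricted to rationals, measurability.
\<close>

lemma at_right_0_Cauchy_iff:
  fixes h :: "real \<Rightarrow> complex"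
  shows "(\<exists>l. (h \<longlongrightarrow> l) (at_right 0)) \<longleftrightarrow>
    (\<forall>k::nat. \<exists>n::nat. \<forall>e\<in>{0<..<1 / real (Suc n)}. \<forall>e'\<in>{0<..<1 / real (Suc n)}.
       norm (h e - h e') \<le> 1 / real (Suc k))" (is "?L \<longleftrightarrow> ?R")
proof
  assume ?L
  then obtain l where l: "(h \<longlongrightarrow> l) (at_right 0)" by blast
  show ?R
  proof
    fix k :: nat
    have "eventually (\<lambda>e. dist (h e) l < 1 / real (Suc k) / 2) (at_right 0)"
      using l by (rule tendstoD) simp
    then obtain b where b: "b > 0" "\<And>e. 0 < e \<Longrightarrow> e < b \<Longrightarrow> dist (h e) l < 1 / real (Suc k) / 2"
      by (auto simp: eventually_at_right_field)
    obtain n where n: "1 / real (Suc n) < b"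
      using reals_Archimedean[OF b(1)] by (auto simp: inverse_eq_divide)
    show "\<exists>n::nat. \<forall>e\<in>{0<..<1 / real (Suc n)}. \<forall>e'\<in>{0<..<1 / real (Suc n)}. norm (h e - h e') \<le> 1 / real (Suc k)"
    proof (intro exI ballI)
      fix e e' assume "e \<in> {0<..<1 / real (Suc n)}" "e' \<in> {0<..<1 / real (Suc n)}"
      then have "0 < e" "e < b" "0 < e'" "e' < b" using n by auto
      then have "dist (h e) l < 1 / real (Suc k) / 2" "dist (h e') l < 1 / real (Suc k) / 2"
        using b(2) by blast+
      then show "norm (h e - h e') \<le> 1 / real (Suc k)"
        using dist_triangle2[of "h e" "h e'" l] unfolding dist_norm[of "h e" "h e'", symmetric] by linarith
    qed
  qed
next
  assume R: ?R
  define a where "a i = h (1 / real (Suc (Suc i)))" for i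
  have a_in: "1 / real (Suc (Suc i)) \<in> {0<..<1 / real (Suc n)}" if "n \<le> i" for i n
    using that by (auto intro!: divide_strict_left_mono)
  have small: "\<exists>k. 1 / real (Suc k) < r" if "0 < r" for r :: real
    using reals_Archimedean[OF that] by (auto simp: inverse_eq_divide)
  have "Cauchy a"
  proof (rule metric_CauchyI)
    fix r :: real assume "0 < r"
    then obtain k where k: "1 / real (Suc k) < r" using small by blast
    obtain n where n: "\<And>e e'. e \<in> {0<..<1 / real (Suc n)} \<Longrightarrow> e' \<in> {0<..<1 / real (Suc n)} \<Longrightarrow> norm (h e - h e') \<le> 1 / real (Suc k)"
      using R by meson
    have "dist (a i) (a j) < r" if "n \<le> i" "n \<le> j" for i j
      unfolding a_def dist_norm using n[OF a_in[OF that(1)] a_in[OF that(2)]] k by linarith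
    then show "\<exists>M. \<forall>m\<ge>M. \<forall>n\<ge>M. dist (a m) (a n) < r" by blast
  qed
  then obtain l where l: "a \<longlonglongrightarrow> l" using Cauchy_convergent_iff convergent_def by blast
  have "(h \<longlongrightarrow> l) (at_right 0)"
  proof (rule tendstoI)
    fix r :: real assume "0 < r"
    then obtain k where k: "1 / real (Suc k) < r" using small by blast
    obtain n where n: "\<And>e e'. e \<in> {0<..<1 / real (Suc n)} \<Longrightarrow> e' \<in> {0<..<1 / real (Suc n)} \<Longrightarrow> norm (h e - h e') \<le> 1 / real (Suc k)"
      using R by meson
    have "dist (h e) l < r" if e: "e \<in> {0<..<1 / real (Suc n)}" for e
    proof -
      have "(\<lambda>i. norm (h e - a i)) \<longlonglongrightarrow> norm (h e - l)" by (intro tendsto_intros l)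
      moreover have "eventually (\<lambda>i. norm (h e - a i) \<le> 1 / real (Suc k)) sequentially"
        using eventually_ge_at_top[of n] by eventually_elim (use n[OF e a_in] a_def in auto)
      ultimately have "norm (h e - l) \<le> 1 / real (Suc k)"
        by (intro tendsto_upperbound) auto
      then show ?thesis using k by (simp add: dist_norm)
    qed
    moreover have "0 < 1 / real (Suc n)" by simp
    ultimately show "eventually (\<lambda>e. dist (h e) l < r) (at_right 0)"
      unfolding eventually_at_right_field by (metis greaterThanLessThan_iff)
  qed
  then show ?L by blast
qed

text \<open>
  The oscillation of the truncations of \<open>f\<close> exceeds that of the truncations of \<open>s i\<close> by at most
  \<open>\<eta> / 2\<close> outside a set of measure \<open>O(\<parallel>f - s i\<parallel>\<^sub>1 / \<eta>)\<close>. The intersection of these sets over all \<open>i\<close>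
  is null, and at a point outside it one good \<open>i\<close> is enough.
\<close>

lemma AE_pv_exists_L1_closed:
  assumes f: "integrable mu f" and s: "\<And>i::nat. integrable mu (s i)"
    and pv: "\<And>i. AE t in mu. pv_exists (s i) t"
    and lim: "(\<lambda>i. LINT x|mu. norm (f x - s i x)) \<longlonglongrightarrow> 0"
  shows "AE t in mu. pv_exists f t"
proof -
  have "AE t in mu. \<exists>n::nat. \<forall>e\<in>{0<..<1 / real (Suc n)}. \<forall>e'\<in>{0<..<1 / real (Suc n)}.
       norm (truncated_hilbert e f t - truncated_hilbert e' f t) \<le> 1 / real (Suc k)" for k
  proof -
    define \<eta> where "\<eta> = 1 / real (Suc k)"
    have \<eta>: "0 < \<eta> / 4" by (simp add: \<eta>_def)
    define d where "d i x = f x - s i x" for i x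
    have intd: "integrable mu (d i)" for i unfolding d_def using f s by simp
    have "\<exists>B\<in>sets borel. emeasure lborel B \<le> ennreal (2560 * pi * (LINT x|mu. norm (d i x)) / (\<eta> / 4)) \<and>
           (\<forall>t. t \<notin> B \<longrightarrow> (\<forall>e>0. norm (truncated_hilbert e (d i) t) \<le> \<eta> / 4))" for i
      by (rule weak_type_truncated[OF intd \<eta>])
    then obtain B where B: "\<And>i. B i \<in> sets borel"
        "\<And>i. emeasure lborel (B i) \<le> ennreal (2560 * pi * (LINT x|mu. norm (d i x)) / (\<eta> / 4))"
        "\<And>i t e. t \<notin> B i \<Longrightarrow> 0 < e \<Longrightarrow> norm (truncated_hilbert e (d i) t) \<le> \<eta> / 4"
      by metis
    have "emeasure lborel (\<Inter>i. B i) \<le> 0"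
    proof (rule LIMSEQ_le_const)
      have "(\<lambda>i. 2560 * pi * (LINT x|mu. norm (d i x)) / (\<eta> / 4)) \<longlonglongrightarrow> 2560 * pi * 0 / (\<eta> / 4)"
        unfolding d_def using \<eta> by (intro tendsto_intros lim) auto
      then have "(\<lambda>i. ennreal (2560 * pi * (LINT x|mu. norm (d i x)) / (\<eta> / 4))) \<longlonglongrightarrow> ennreal (2560 * pi * 0 / (\<eta> / 4))"
        by (rule tendsto_ennrealI)
      then show "(\<lambda>i. ennreal (2560 * pi * (LINT x|mu. norm (d i x)) / (\<eta> / 4))) \<longlonglongrightarrow> 0" by simp
      have "emeasure lborel (\<Inter>i. B i) \<le> ennreal (2560 * pi * (LINT x|mu. norm (d i x)) / (\<eta> / 4))" for i
        by (rule order_trans[OF emeasure_mono B(2)]) (use B(1) in auto)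
      then show "\<exists>N. \<forall>i\<ge>N. emeasure lborel (\<Inter>i. B i) \<le> ennreal (2560 * pi * (LINT x|mu. norm (d i x)) / (\<eta> / 4))"
        by blast
    qed
    then have "(\<Inter>i. B i) \<in> null_sets lborel" using B(1) by (intro null_setsI) auto
    then have "AE t in lborel. t \<notin> (\<Inter>i. B i)" by (rule AE_not_in)
    then have "AE t in mu. t \<notin> (\<Inter>i. B i)" unfolding AE_mu_iff by auto
    moreover have "AE t in mu. \<forall>i. pv_exists (s i) t" using pv by (simp add: AE_all_countable)
    ultimately show ?thesis
    proof eventually_elim
      case (elim t)
      then obtain i where i: "t \<notin> B i" by blast
      \<comment> \<open>Index of the Cauchy condition whose tolerance \<open>1 / (k' + 1)\<close> is exactly \<open>\<eta> / 2\<close>.\<close>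
      define k' where "k' = 2 * k + 1"
      have k': "1 / real (Suc k') = \<eta> / 2" by (simp add: k'_def \<eta>_def field_simps)
      obtain n where n: "\<And>e e'. e \<in> {0<..<1 / real (Suc n)} \<Longrightarrow> e' \<in> {0<..<1 / real (Suc n)} \<Longrightarrow>
          norm (truncated_hilbert e (s i) t - truncated_hilbert e' (s i) t) \<le> \<eta> / 2"
        using elim(2)[rule_format, of i, unfolded pv_exists_def at_right_0_Cauchy_iff] k' by metis
      have split: "truncated_hilbert e f t = truncated_hilbert e (d i) t + truncated_hilbert e (s i) t" if "0 < e" for e
        using truncated_hilbert_add[OF intd[of i] s[of i] that, of t] by (simp add: d_def)
      show ?case
      proof (intro exI ballI)
        fix e e' assume e: "e \<in> {0<..<1 / real (Suc n)}" "e' \<in> {0<..<1 / real (Suc n)}"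
        have "truncated_hilbert e f t - truncated_hilbert e' f t
          = truncated_hilbert e (d i) t - truncated_hilbert e' (d i) t + (truncated_hilbert e (s i) t - truncated_hilbert e' (s i) t)"
          using e by (simp add: split)
        also have "norm \<dots> \<le> (\<eta> / 4 + \<eta> / 4) + \<eta> / 2"
          using e i by (intro norm_triangle_le add_mono n norm_triangle_le_diff B(3)) auto
        also have "(\<eta> / 4 + \<eta> / 4) + \<eta> / 2 = \<eta>" by simp
        finally show "norm (truncated_hilbert e f t - truncated_hilbert e' f t) \<le> 1 / real (Suc k)"
          by (simp only: \<eta>_def)
      qed
    qed
  qed
  then have "AE t in mu. \<forall>k::nat. \<exists>n::nat. \<forall>e\<in>{0<..<1 / real (Suc n)}. \<forall>e'\<in>{0<..<1 / real (Suc n)}.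
       norm (truncated_hilbert e f t - truncated_hilbert e' f t) \<le> 1 / real (Suc k)"
    by (simp only: AE_all_countable) blast
  then show ?thesis by (simp only: pv_exists_def at_right_0_Cauchy_iff)
qed

lemma L1_dominated_convergence:
  fixes f :: "real \<Rightarrow> complex"
  assumes f: "f \<in> borel_measurable mu" and s: "\<And>i. s i \<in> borel_measurable mu"
    and w: "integrable mu w"
    and lim: "\<And>x. x \<in> space mu \<Longrightarrow> (\<lambda>i. s i x) \<longlonglongrightarrow> f x"
    and le: "\<And>i x. x \<in> space mu \<Longrightarrow> norm (f x - s i x) \<le> w x"
  shows "(\<lambda>i. LINT x|mu. norm (f x - s i x)) \<longlonglongrightarrow> 0"
proof -
  have "(\<lambda>i. LINT x|mu. norm (f x - s i x)) \<longlonglongrightarrow> (LINT x|mu. 0)"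
  proof (rule integral_dominated_convergence[where w = w])
    show "AE x in mu. (\<lambda>i. norm (f x - s i x)) \<longlonglongrightarrow> 0"
    proof (rule AE_I2)
      fix x assume "x \<in> space mu"
      from tendsto_norm[OF tendsto_diff[OF tendsto_const lim[OF this]], of "f x"]
      show "(\<lambda>i. norm (f x - s i x)) \<longlonglongrightarrow> 0" by simp
    qed
    show "AE x in mu. norm (norm (f x - s i x)) \<le> w x" for i
      by (rule AE_I2) (use le in auto)
  qed (use f s w in auto)
  then show ?thesis by simp
qed

text \<open>
  The integrand is the kernel restricted to an annulus centred at \<open>t\<close> and contained in the interval, so it
  is odd under reflection at \<open>t\<close>.
\<close>

lemma truncated_kernel_annulus_integral:
  assumes e: "0 < e" and r: "e < r" and sub: "{t - r..t + r} \<subseteq> {-1<..<1}"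
  shows "(LINT x|mu. truncated_kernel e t x - truncated_kernel r t x) = 0"
proof -
  define k where "k x = truncated_kernel e t x - truncated_kernel r t x" for x
  have supp: "k x = 0" if "x \<notin> {-1<..<1}" for x
  proof -
    have "x \<notin> {t - r..t + r}" using that sub by blast
    then have "r < \<bar>x - t\<bar>" by auto
    then show ?thesis using r by (simp add: k_def truncated_kernel_def)
  qed
  have odd: "k (2 * t + (-1) * x) = - k x" for x
    by (auto simp: k_def truncated_kernel_def abs_minus_commute minus_divide_right)
  have "(LINT x|mu. k x) = (LINT x|lborel. indicator {-1<..<1} x *\<^sub>R k x)"
    by (intro integral_restrict_space) simp
  also have "\<dots> = (LINT x|lborel. k x)"
    using supp by (intro Bochner_Integration.integral_cong refl) (auto simp: indicator_def)
  also have "\<dots> = 0"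
    using lborel_integral_real_affine[of "-1" k "2 * t"] unfolding odd by simp
  finally show ?thesis by (simp add: k_def)
qed

lemma pv_exists_locally_constant:
  assumes f: "integrable mu f" and r: "0 < r" and sub: "{t - r..t + r} \<subseteq> {-1<..<1}"
    and const: "\<And>x. \<bar>x - t\<bar> \<le> r \<Longrightarrow> f x = c"
  shows "pv_exists f t"
proof -
  have "truncated_hilbert e f t = truncated_hilbert r f t" if e: "0 < e" "e < r" for e
  proof -
    have "truncated_hilbert e f t - truncated_hilbert r f t = of_real (1 / pi) *
       (LINT x|mu. f x * of_real (truncated_kernel e t x) - f x * of_real (truncated_kernel r t x))"
      using integrable_times_truncated_kernel[OF f] e r f
      by (simp add: truncated_hilbert_eq right_diff_distrib)
    also have "(LINT x|mu. f x * of_real (truncated_kernel e t x) - f x * of_real (truncated_kernel r t x))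
       = (LINT x|mu. c * of_real (truncated_kernel e t x - truncated_kernel r t x))"
      using const e by (intro Bochner_Integration.integral_cong refl) (auto simp: truncated_kernel_def)
    also have "\<dots> = c * of_real (LINT x|mu. truncated_kernel e t x - truncated_kernel r t x)"
      by (simp only: integral_mult_right_zero integral_complex_of_real)
    also have "\<dots> = 0"
      using truncated_kernel_annulus_integral[OF e sub] by simp
    finally show ?thesis by simp
  qed
  then have "eventually (\<lambda>e. truncated_hilbert e f t = truncated_hilbert r f t) (at_right 0)"
    unfolding eventually_at_right_field using r by blast
  then have "((\<lambda>e. truncated_hilbert e f t) \<longlongrightarrow> truncated_hilbert r f t) (at_right 0)"
    by (rule tendsto_eventually)
  then show ?thesis unfolding pv_exists_def by blast
qed

lemma integrable_indicator_mu:
  "A \<in> sets borel \<Longrightarrow> integrable mu (indicator A :: real \<Rightarrow> complex)"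
  by (rule mu.integrable_const_bound[where B = 1])
     (auto simp: indicator_def measurable_restrict_space1 intro!: borel_measurable_indicator)

text \<open>
  The indicator of a half line is constant near every point except its end point, and half lines form an
  intersection-stable generator of the Borel sets. Complements are covered by linearity, countable
  disjoint unions by closedness under convergence in \<open>L\<^sup>1\<close>.
\<close>

lemma AE_pv_exists_indicator:
  assumes "A \<in> sets borel"
  shows "AE t in mu. pv_exists (indicator A) t"
proof -
  have cover: "AE t in mu. pv_exists (indicator {..a}) t" for a
  proof -
    have "AE t in lborel. t \<noteq> a" by (rule AE_lborel_singleton)
    then have "AE t in mu. t \<noteq> a" unfolding AE_mu_iff by auto
    moreover have "AE t in mu. t \<in> {-1<..<1}" by (rule AE_I2) (simp add: space_restrict_space)
    ultimately show ?thesis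
    proof eventually_elim
      case (elim t)
      define m where "m = min (\<bar>t - a\<bar>) (min (1 - t) (t + 1))"
      define r where "r = m / 2"
      have "0 < m" "m \<le> \<bar>t - a\<bar>" "m \<le> 1 - t" "m \<le> t + 1" using elim by (auto simp: m_def)
      then have r: "0 < r" "r < \<bar>t - a\<bar>" "r < 1 - t" "r < t + 1" by (auto simp: r_def)
      show ?case
      proof (rule pv_exists_locally_constant[where r = r and c = "indicator {..a} t"])
        show "indicator {..a} x = (indicator {..a} t :: complex)" if "\<bar>x - t\<bar> \<le> r" for x
          using that r by (auto simp: indicator_def abs_le_iff abs_if split: if_splits)
      qed (use r integrable_indicator_mu in auto)
    qed
  qed
  have UNIV: "AE t in mu. pv_exists (indicator UNIV) t"
  proof (rule AE_mp[OF cover[of 1]], rule AE_I2, rule impI)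
    fix t assume "pv_exists (indicator {..1}) t"
    then obtain l where l: "((\<lambda>e. truncated_hilbert e (indicator {..1}) t) \<longlongrightarrow> l) (at_right 0)"
      unfolding pv_exists_def by blast
    have "truncated_hilbert e (indicator {..1}) t = truncated_hilbert e (indicator UNIV) t" if "0 < e" for e
    proof -
      have "(LINT x|mu. indicator {..1} x * complex_of_real (truncated_kernel e t x))
          = (LINT x|mu. indicator UNIV x * complex_of_real (truncated_kernel e t x))"
        by (intro Bochner_Integration.integral_cong refl) (auto simp: indicator_def space_restrict_space)
      then show ?thesis
        using that integrable_indicator_mu[of "{..1}"] integrable_indicator_mu[of UNIV]
        by (simp add: truncated_hilbert_eq)
    qed
    then have "eventually (\<lambda>e. truncated_hilbert e (indicator {..1}) t = truncated_hilbert e (indicator UNIV) t) (at_right 0)"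
      by (rule eventually_mono[OF eventually_at_right_less])
    then show "pv_exists (indicator UNIV) t"
      unfolding pv_exists_def by (intro exI) (rule Lim_transform_eventually[OF l])
  qed
  have "pv_exists (indicator {}) t" for t
    using tendsto_const by (force simp: pv_exists_def truncated_hilbert_def)
  then have pv_zero: "AE t in mu. pv_exists (indicator {}) t" by simp
  have sb: "sets (borel :: real measure) = sigma_sets UNIV (range atMost)"
    by (simp add: borel_eq_atMost)
  have A: "A \<in> sigma_sets UNIV (range (atMost :: real \<Rightarrow> real set))" using assms by (simp add: sb)
  have stable: "Int_stable (range (atMost :: real \<Rightarrow> real set))"
    by (auto simp: Int_stable_def)
  have "range (atMost :: real \<Rightarrow> real set) \<subseteq> Pow UNIV" by simp
  with stable show ?thesis using A
  proof (induction rule: sigma_sets_induct_disjoint)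
    case (basic A) then show ?case using cover by auto
  next
    case empty
    show ?case by (rule pv_zero)
  next
    case (compl A)
    have eq: "indicator (UNIV - A) = (\<lambda>x. indicator UNIV x + (- 1) * indicator A x :: complex)"
      by (auto simp: indicator_def fun_eq_iff)
    have A: "A \<in> sets borel" using compl sb by simp
    have intm: "integrable mu (\<lambda>x. (- 1) * indicator A x :: complex)"
      using integrable_indicator_mu[OF A] by simp
    show ?case unfolding eq
      by (rule AE_pv_add[OF _ intm UNIV AE_pv_scale[OF integrable_indicator_mu[OF A] compl(2)]])
         (simp add: integrable_indicator_mu del: indicator_UNIV)
  next
    case (union A)
    have A: "A i \<in> sets borel" for i using union(2) sb by auto
    have UA: "(\<Union>i. A i) \<in> sets borel" using A by auto
    define U where "U n = (\<Union>i<n. A i)" for n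
    have U: "U n \<in> sets borel" for n unfolding U_def using A by (intro sets.finite_UN) auto
    have pvU: "AE t in mu. pv_exists (indicator (U n)) t" for n
    proof (induction n)
      case 0
      have "U 0 = {}" by (simp add: U_def)
      then show ?case using pv_zero by (simp only:)
    next
      case (Suc n)
      have "A i \<inter> A n = {}" if "i < n" for i
        using disjoint_family_onD[OF union(1), of i n] that by simp
      then have "U n \<inter> A n = {}" unfolding U_def by blast
      then have eq: "indicator (U (Suc n)) = (\<lambda>x. indicator (U n) x + indicator (A n) x :: complex)"
        by (auto simp: U_def lessThan_Suc indicator_def fun_eq_iff)
      show ?case unfolding eq
        by (rule AE_pv_add[OF integrable_indicator_mu[OF U] integrable_indicator_mu[OF A] Suc union(3)])
    qed
    show ?case
    proof (rule AE_pv_exists_L1_closed[OF _ _ pvU])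
      show "(\<lambda>i. LINT x|mu. norm (indicator (\<Union>i. A i) x - (indicator (U i) x :: complex))) \<longlonglongrightarrow> 0"
      proof (rule L1_dominated_convergence[where w = "\<lambda>_. 1"])
        show "(\<lambda>i. indicator (U i) x :: complex) \<longlonglongrightarrow> indicator (\<Union>i. A i) x" for x
          unfolding U_def by (rule LIMSEQ_indicator_UN)
        show "norm (indicator (\<Union>i. A i) x - (indicator (U i) x :: complex)) \<le> 1" for i x
          by (auto simp: indicator_def)
      qed (use borel_measurable_integrable[OF integrable_indicator_mu[OF UA]] 
             borel_measurable_integrable[OF integrable_indicator_mu[OF U]] in simp_all)
    qed (rule integrable_indicator_mu[OF UA] integrable_indicator_mu[OF U])+
  qed
qed

theorem AE_pv_exists:
  assumes "integrable mu f"
  shows "AE t in mu. pv_exists f t"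
  using assms
proof (induction rule: integrable_induct)
  case (base A c)
  have A: "A \<in> sets borel" using base by (auto simp: sets_restrict_space)
  have eq: "(\<lambda>x. indicator A x *\<^sub>R c) = (\<lambda>x. c * indicator A x)"
    by (auto simp: indicator_def fun_eq_iff)
  show ?case unfolding eq
    by (intro AE_pv_scale AE_pv_exists_indicator integrable_indicator_mu A)
next
  case (add f g)
  then show ?case by (rule AE_pv_add)
next
  case (lim f s)
  show ?case
  proof (rule AE_pv_exists_L1_closed[OF lim(4) lim(1) lim(5)])
    show "(\<lambda>i. LINT x|mu. norm (f x - s i x)) \<longlonglongrightarrow> 0"
    proof (rule L1_dominated_convergence[where w = "\<lambda>x. 3 * norm (f x)"])
      fix i x assume "x \<in> space mu"
      then show "norm (f x - s i x) \<le> 3 * norm (f x)"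
        using norm_triangle_ineq4[of "f x" "s i x"] lim(3)[of x i] by linarith
    qed (use lim in auto)
  qed
qed

section \<open>Measurability and linearity of the finite Hilbert transform\<close>

text \<open>
  Changing the truncation radius to a nearby one alters the kernel only near the two points at distance
  \<open>e\<close> from \<open>t\<close>, which form a null set.
\<close>

lemma truncated_hilbert_isCont:
  assumes f: "integrable mu f" and e: "0 < e"
  shows "isCont (\<lambda>e. truncated_hilbert e f t) e"
proof -
  define d where "d = e / 2"
  have d: "0 < d" "d < e" using e by (auto simp: d_def)
  have [measurable]: "f \<in> borel_measurable mu" using f by simp
  have km[measurable]: "truncated_kernel a t \<in> borel_measurable mu" for a
    by (simp add: measurable_restrict_space1)
  have "continuous_on {d<..} (\<lambda>e. truncated_hilbert e f t)"
  proof (rule continuous_on_sequentiallyI)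
    fix u a assume u: "\<forall>n. u n \<in> {d<..}" and a: "a \<in> {d<..}" and lim: "u \<longlonglongrightarrow> a"
    have "(\<lambda>n. LINT x|mu. f x * of_real (truncated_kernel (u n) t x)) \<longlonglongrightarrow> (LINT x|mu. f x * of_real (truncated_kernel a t x))"
    proof (rule integral_dominated_convergence[where w = "\<lambda>x. norm (f x) / d"])
      have "AE x in lborel. x \<noteq> t - a" "AE x in lborel. x \<noteq> t + a" by (rule AE_lborel_singleton)+
      then have "AE x in lborel. \<bar>x - t\<bar> \<noteq> a" by eventually_elim auto
      then have "AE x in mu. \<bar>x - t\<bar> \<noteq> a" unfolding AE_mu_iff by auto
      then show "AE x in mu. (\<lambda>n. f x * of_real (truncated_kernel (u n) t x)) \<longlonglongrightarrow> f x * of_real (truncated_kernel a t x)"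
      proof eventually_elim
        case (elim x)
        have "eventually (\<lambda>n. truncated_kernel (u n) t x = truncated_kernel a t x) sequentially"
        proof (cases "a < \<bar>x - t\<bar>")
          case True
          have "eventually (\<lambda>n. u n < \<bar>x - t\<bar>) sequentially" using lim True by (rule order_tendstoD)
          then show ?thesis by eventually_elim (use True in \<open>simp add: truncated_kernel_def\<close>)
        next
          case False
          then have "\<bar>x - t\<bar> < a" using elim by simp
          with lim have "eventually (\<lambda>n. \<bar>x - t\<bar> < u n) sequentially" by (rule order_tendstoD)
          then show ?thesis by eventually_elim (use False in \<open>simp add: truncated_kernel_def\<close>)
        qed
        then have "eventually (\<lambda>n. f x * of_real (truncated_kernel (u n) t x) = f x * of_real (truncated_kernel a t x)) sequentially"
          by eventually_elim simp
        then show ?case by (rule tendsto_eventually)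
      qed
      show "AE x in mu. norm (f x * of_real (truncated_kernel (u n) t x)) \<le> norm (f x) / d" for n
      proof (rule AE_I2)
        fix x
        have un: "d < u n" using u by auto
        then have "1 / u n \<le> 1 / d" using d by (simp add: frac_le)
        moreover have "\<bar>truncated_kernel (u n) t x\<bar> \<le> 1 / u n" using un d by (intro truncated_kernel_le) simp
        ultimately have "norm (f x) * \<bar>truncated_kernel (u n) t x\<bar> \<le> norm (f x) * (1 / d)"
          by (intro mult_left_mono) auto
        then show "norm (f x * of_real (truncated_kernel (u n) t x)) \<le> norm (f x) / d"
          by (simp add: norm_mult)
      qed
      show "integrable mu (\<lambda>x. norm (f x) / d)" using f by simp
    qed measurable
    then have "(\<lambda>n. of_real (1 / pi) * (LINT x|mu. f x * of_real (truncated_kernel (u n) t x)))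
        \<longlonglongrightarrow> of_real (1 / pi) * (LINT x|mu. f x * of_real (truncated_kernel a t x))"
      by (rule tendsto_mult_left)
    moreover have "0 < u n" for n using u[rule_format, of n] d by simp
    moreover have "0 < a" using a d by simp
    ultimately show "(\<lambda>n. truncated_hilbert (u n) f t) \<longlonglongrightarrow> truncated_hilbert a f t"
      by (simp only: truncated_hilbert_eq[OF f])
  qed
  then show ?thesis using d by (simp add: continuous_on_eq_continuous_at)
qed

lemma bound_on_rationals_extends:
  fixes h :: "real \<Rightarrow> real"
  assumes "isCont h e" "0 < e" "e < d" and q: "\<And>q::rat. 0 < real_of_rat q \<Longrightarrow> real_of_rat q < d \<Longrightarrow> h (real_of_rat q) \<le> c"
  shows "h e \<le> c"
proof (rule ccontr)
  assume "\<not> h e \<le> c"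
  then have "eventually (\<lambda>x. c < h x) (at_right e)"
    using assms(1) by (intro order_tendstoD(1)[of h "h e"]) (auto simp: isCont_def filterlim_at_split)
  then obtain b where b: "e < b" "\<And>x. e < x \<Longrightarrow> x < b \<Longrightarrow> c < h x"
    by (auto simp: eventually_at_right_field)
  obtain p :: rat where p: "e < real_of_rat p" "real_of_rat p < min b d"
    using of_rat_dense[of e "min b d"] b assms(3) by auto
  have "h (real_of_rat p) \<le> c"
    by (rule q) (use p assms(2) in linarith)+
  then show False using b(2)[of "real_of_rat p"] p by simp
qed

text \<open>
  The set of convergence must be a Borel set, not merely the complement of a null set, because \<open>L0\<close> asks
  for measurability with respect to the uncompleted \<open>\<sigma>\<close>-algebra. Restricting the radii to rationals
  expresses it by countable operations.
\<close>

lemma pv_exists_iff_rational: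
  assumes f: "integrable mu f"
  shows "pv_exists f t \<longleftrightarrow> (\<forall>k::nat. \<exists>n::nat. \<forall>p::rat. \<forall>q::rat.
     0 < real_of_rat p \<and> real_of_rat p < 1 / real (Suc n) \<longrightarrow>
     0 < real_of_rat q \<and> real_of_rat q < 1 / real (Suc n) \<longrightarrow>
       norm (truncated_hilbert (real_of_rat p) f t - truncated_hilbert (real_of_rat q) f t) \<le> 1 / real (Suc k))"
    (is "_ \<longleftrightarrow> (\<forall>k. \<exists>n. ?Q k n)")
proof -
  let ?R = "\<lambda>k n. \<forall>e\<in>{0<..<1 / real (Suc n)}. \<forall>e'\<in>{0<..<1 / real (Suc n)}.
     norm (truncated_hilbert e f t - truncated_hilbert e' f t) \<le> 1 / real (Suc k)"
  have "?R k n" if Q: "?Q k n" for k n :: nat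
  proof (intro ballI)
    fix e e' assume e: "e \<in> {0<..<1 / real (Suc n)}" and e': "e' \<in> {0<..<1 / real (Suc n)}"
    show "norm (truncated_hilbert e f t - truncated_hilbert e' f t) \<le> 1 / real (Suc k)"
    proof (rule bound_on_rationals_extends[where e = e and d = "1 / real (Suc n)"])
      show "isCont (\<lambda>e. norm (truncated_hilbert e f t - truncated_hilbert e' f t)) e"
        using e by (intro continuous_intros truncated_hilbert_isCont f) auto
      fix p :: rat assume p: "0 < real_of_rat p" "real_of_rat p < 1 / real (Suc n)"
      show "norm (truncated_hilbert (real_of_rat p) f t - truncated_hilbert e' f t) \<le> 1 / real (Suc k)"
      proof (rule bound_on_rationals_extends[where e = e' and d = "1 / real (Suc n)"])
        show "isCont (\<lambda>e'. norm (truncated_hilbert (real_of_rat p) f t - truncated_hilbert e' f t)) e'"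
          using e' by (intro continuous_intros truncated_hilbert_isCont f) auto
      qed (use e' p Q in auto)
    qed (use e in auto)
  qed
  moreover have "?Q k n" if "?R k n" for k n :: nat
    using that by auto
  ultimately have "?R k n \<longleftrightarrow> ?Q k n" for k n :: nat by blast
  then show ?thesis unfolding pv_exists_def at_right_0_Cauchy_iff by simp
qed

lemma truncated_hilbert_measurable:
  assumes f: "integrable mu f" and e: "0 < e"
  shows "truncated_hilbert e f \<in> borel_measurable mu"
proof -
  have [measurable]: "f \<in> borel_measurable mu" using f by simp
  have [measurable]: "(\<lambda>x. x) \<in> measurable mu borel" by (simp add: measurable_restrict_space1)
  have eq: "truncated_hilbert e f = (\<lambda>t. of_real (1 / pi) * (LINT x|mu. f x * of_real (truncated_kernel e t x)))"
    by (rule ext) (rule truncated_hilbert_eq[OF f e])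
  have "(\<lambda>t. LINT x|mu. f x * of_real (truncated_kernel e t x)) \<in> borel_measurable mu"
    unfolding truncated_kernel_def
    by (rule mu.borel_measurable_lebesgue_integral) measurable
  then show ?thesis unfolding eq by (intro borel_measurable_times borel_measurable_const)
qed

theorem finite_hilbert_measurable:
  assumes f: "integrable mu f"
  shows "finite_hilbert f \<in> L0"
proof -
  have T[measurable]: "truncated_hilbert e f \<in> borel_measurable mu" if "0 < e" for e
    by (rule truncated_hilbert_measurable[OF f that])
  \<comment> \<open>Extended by \<open>0\<close> to all radii, so that measurability holds for every rational radius and not
    only for the positive ones.\<close>
  define S where "S e t = (if 0 < e then truncated_hilbert e f t else 0)" for e t
  have S[measurable]: "S e \<in> borel_measurable mu" for e
    unfolding S_def[abs_def] by (cases "0 < e") (simp_all add: T)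
  have pv: "pv_exists f t \<longleftrightarrow> (\<forall>k::nat. \<exists>n::nat. \<forall>p::rat. \<forall>q::rat.
     0 < real_of_rat p \<and> real_of_rat p < 1 / real (Suc n) \<longrightarrow>
     0 < real_of_rat q \<and> real_of_rat q < 1 / real (Suc n) \<longrightarrow>
       norm (S (real_of_rat p) t - S (real_of_rat q) t) \<le> 1 / real (Suc k))" for t
    unfolding pv_exists_iff_rational[OF f] S_def by (intro all_cong1 ex_cong1) auto
  have [measurable]: "Measurable.pred mu (pv_exists f)"
    unfolding pv[abs_def] by measurable
  have eq: "finite_hilbert f t = (if pv_exists f t then lim (\<lambda>n. S (1 / real (Suc n)) t) else 0)" for t
  proof (cases "pv_exists f t")
    case True
    have "filterlim (\<lambda>n. 1 / real (Suc n)) (at_right 0) sequentially"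
      unfolding filterlim_at using LIMSEQ_inverse_real_of_nat by (simp add: inverse_eq_divide)
    from filterlim_compose[OF finite_hilbert_limit[OF True] this]
    have "(\<lambda>n. S (1 / real (Suc n)) t) \<longlonglongrightarrow> finite_hilbert f t" by (simp add: S_def)
    then show ?thesis using True by (simp add: limI)
  next
    case False
    then show ?thesis by (simp add: finite_hilbert_def pv_exists_def)
  qed
  have "(\<lambda>t. lim (\<lambda>n. S (1 / real (Suc n)) t)) \<in> borel_measurable mu"
    by (rule borel_measurable_lim_metric) (rule S)
  then show ?thesis unfolding eq[abs_def] by measurable
qed

lemma finite_hilbert_add_AE:
  assumes "integrable mu f" "integrable mu g"
  shows "AE t in mu. finite_hilbert (\<lambda>x. f x + g x) t = finite_hilbert f t + finite_hilbert g t"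
  by (rule AE_mp[OF AE_pv_exists[OF assms(1)]], rule AE_mp[OF AE_pv_exists[OF assms(2)]])
     (auto intro!: AE_I2 pv_add assms)

lemma finite_hilbert_scale_AE:
  assumes "integrable mu f"
  shows "AE t in mu. finite_hilbert (\<lambda>x. c * f x) t = c * finite_hilbert f t"
  by (rule AE_mp[OF AE_pv_exists[OF assms]]) (auto intro!: AE_I2 pv_scale assms)

lemma finite_hilbert_diff_AE:
  assumes "integrable mu f" "integrable mu g"
  shows "AE t in mu. finite_hilbert (\<lambda>x. f x - g x) t = finite_hilbert f t - finite_hilbert g t"
proof -
  have "AE t in mu. finite_hilbert (\<lambda>x. f x + (- 1) * g x) t = finite_hilbert f t + finite_hilbert (\<lambda>x. (- 1) * g x) t"
    using assms by (intro finite_hilbert_add_AE integrable_mult_right)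
  moreover have "AE t in mu. finite_hilbert (\<lambda>x. (- 1) * g x) t = (- 1) * finite_hilbert g t"
    using assms by (intro finite_hilbert_scale_AE)
  ultimately show ?thesis by eventually_elim simp
qed

lemma finite_hilbert_sum_AE:
  assumes "finite I" "\<And>i. i \<in> I \<Longrightarrow> integrable mu (f i)"
  shows "AE t in mu. finite_hilbert (\<lambda>x. \<Sum>i\<in>I. f i x) t = (\<Sum>i\<in>I. finite_hilbert (f i) t)"
  using assms
proof (induction I rule: finite_induct)
  case empty
  show ?case using finite_hilbert_scale_AE[of "\<lambda>_. 0" 0] by simp
next
  case (insert i I)
  have "AE t in mu. finite_hilbert (\<lambda>x. f i x + (\<Sum>i\<in>I. f i x)) t = finite_hilbert (f i) t + finite_hilbert (\<lambda>x. \<Sum>i\<in>I. f i x) t"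
    using insert by (intro finite_hilbert_add_AE Bochner_Integration.integrable_sum) auto
  moreover have "AE t in mu. finite_hilbert (\<lambda>x. \<Sum>i\<in>I. f i x) t = (\<Sum>i\<in>I. finite_hilbert (f i) t)"
    using insert by auto
  ultimately show ?case by eventually_elim (use insert in simp)
qed

section \<open>Convergence in measure\<close>

lemma saturate_mono: "0 \<le> a \<Longrightarrow> a \<le> b \<Longrightarrow> a / (1 + a) \<le> b / (1 + b)" for a b :: real
  by (simp add: divide_simps) (simp add: algebra_simps)

lemma saturate_le: "0 \<le> a \<Longrightarrow> a / (1 + a) \<le> 1" "0 \<le> a \<Longrightarrow> a / (1 + a) \<le> a" for a :: real
  by (simp_all add: divide_le_eq distrib_left)

lemma saturate_subadditive: "0 \<le> a \<Longrightarrow> 0 \<le> b \<Longrightarrow> (a + b) / (1 + (a + b)) \<le> a / (1 + a) + b / (1 + b)" for a b :: real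
proof -
  assume "0 \<le> a" "0 \<le> b"
  then have "a / (1 + (a + b)) \<le> a / (1 + a)" "b / (1 + (a + b)) \<le> b / (1 + b)"
    by (auto intro!: divide_left_mono mult_pos_pos)
  then show ?thesis by (simp add: add_divide_distrib)
qed

lemma integrable_saturate:
  assumes "g \<in> L0"
  shows "integrable mu (\<lambda>x. norm (g x) / (1 + norm (g x)))"
proof (rule mu.integrable_const_bound[where B = 1])
  have [measurable]: "g \<in> borel_measurable mu" by fact
  show "(\<lambda>x. norm (g x) / (1 + norm (g x))) \<in> borel_measurable mu" by measurable
  show "AE x in mu. norm (norm (g x) / (1 + norm (g x))) \<le> 1"
    by (rule AE_I2) (simp add: saturate_le)
qed

lemma L0_fnorm_nonneg: "0 \<le> L0_fnorm g"
  unfolding L0_fnorm_def by (intro Bochner_Integration.integral_nonneg) auto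

lemma L0_fnorm_cong_AE:
  assumes "f \<in> L0" "g \<in> L0" "AE x in mu. f x = g x"
  shows "L0_fnorm f = L0_fnorm g"
  unfolding L0_fnorm_def
proof (rule integral_cong_AE)
  show "AE x in mu. norm (f x) / (1 + norm (f x)) = norm (g x) / (1 + norm (g x))"
    using assms(3) by eventually_elim simp
qed (use integrable_saturate assms in auto)

lemma L0_fnorm_uminus: "L0_fnorm (\<lambda>x. - g x) = L0_fnorm g"
  by (simp add: L0_fnorm_def)

lemma L0_fnorm_triangle:
  assumes "f \<in> L0" "g \<in> L0"
  shows "L0_fnorm (\<lambda>x. f x + g x) \<le> L0_fnorm f + L0_fnorm g"
proof -
  have fg: "(\<lambda>x. f x + g x) \<in> L0" using assms by measurable
  have "L0_fnorm (\<lambda>x. f x + g x) \<le> (LINT x|mu. norm (f x) / (1 + norm (f x)) + norm (g x) / (1 + norm (g x)))"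
    unfolding L0_fnorm_def
  proof (rule Bochner_Integration.integral_mono)
    fix x
    have "norm (f x + g x) / (1 + norm (f x + g x)) \<le> (norm (f x) + norm (g x)) / (1 + (norm (f x) + norm (g x)))"
      by (intro saturate_mono norm_triangle_ineq) auto
    also have "\<dots> \<le> norm (f x) / (1 + norm (f x)) + norm (g x) / (1 + norm (g x))"
      by (intro saturate_subadditive) auto
    finally show "norm (f x + g x) / (1 + norm (f x + g x)) \<le> norm (f x) / (1 + norm (f x)) + norm (g x) / (1 + norm (g x))" .
  qed (use integrable_saturate[OF fg] integrable_saturate assms in auto)
  then show ?thesis
    unfolding L0_fnorm_def using integrable_saturate assms by simp
qed

lemma L0_fnorm_eq_0:
  assumes "g \<in> L0" "L0_fnorm g = 0"
  shows "AE x in mu. g x = 0"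
proof -
  have "AE x in mu. norm (g x) / (1 + norm (g x)) = 0"
    using assms(2) integrable_saturate[OF assms(1)] unfolding L0_fnorm_def
    by (subst (asm) integral_nonneg_eq_0_iff_AE) auto
  then show ?thesis
    by eventually_elim (auto simp: add_nonneg_eq_0_iff)
qed

text \<open>
  Off the exceptional set of the maximal inequality the transform is at most \<open>l\<close>, and on it the integrand
  of the F-norm is at most \<open>1\<close>; the interval has length \<open>2\<close>.
\<close>

lemma L0_fnorm_finite_hilbert_le:
  assumes f: "integrable mu f" and l: "0 < l"
  shows "L0_fnorm (finite_hilbert f) \<le> 2 * l + 2560 * pi * (LINT x|mu. norm (f x)) / l"
proof -
  define c where "c = 2560 * pi * (LINT x|mu. norm (f x)) / l"
  have c: "0 \<le> c" using l by (simp add: c_def)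
  obtain B where B: "B \<in> sets borel" "emeasure lborel B \<le> ennreal c"
    and le: "\<And>t e. t \<notin> B \<Longrightarrow> 0 < e \<Longrightarrow> norm (truncated_hilbert e f t) \<le> l"
    using weak_type_truncated[OF f l] unfolding c_def by blast
  define B' where "B' = B \<inter> {-1<..<1}"
  have B': "B' \<in> sets mu" using B by (auto simp: B'_def sets_restrict_space)
  have "emeasure mu B' = emeasure lborel B'"
    using B by (subst emeasure_restrict_space) (auto simp: B'_def)
  also have "\<dots> \<le> emeasure lborel B" using B by (intro emeasure_mono) (auto simp: B'_def)
  also have "\<dots> \<le> ennreal c" by fact
  finally have mB: "measure mu B' \<le> c" using c by (simp add: mu.emeasure_eq_measure)
  have "L0_fnorm (finite_hilbert f) \<le> (LINT t|mu. l + indicator B' t)"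
    unfolding L0_fnorm_def
  proof (rule integral_mono_AE)
    show "integrable mu (\<lambda>t. norm (finite_hilbert f t) / (1 + norm (finite_hilbert f t)))"
      by (rule integrable_saturate[OF finite_hilbert_measurable[OF f]])
    show "integrable mu (\<lambda>t. l + indicator B' t)" using B' by (simp add: mu.emeasure_eq_measure)
    have "AE t in mu. t \<in> space mu" by (rule AE_space)
    with AE_pv_exists[OF f]
    show "AE t in mu. norm (finite_hilbert f t) / (1 + norm (finite_hilbert f t)) \<le> l + indicator B' t"
    proof eventually_elim
      case (elim t)
      show ?case
      proof (cases "t \<in> B")
        case True
        then have "t \<in> B'" using elim by (auto simp: B'_def space_restrict_space)
        moreover have "norm (finite_hilbert f t) / (1 + norm (finite_hilbert f t)) \<le> 1" by (rule saturate_le) simp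
        ultimately show ?thesis using l by simp
      next
        case False
        have "norm (finite_hilbert f t) \<le> l"
        proof (rule tendsto_upperbound[OF tendsto_norm[OF finite_hilbert_limit[OF elim(1)]]])
          show "eventually (\<lambda>e. norm (truncated_hilbert e f t) \<le> l) (at_right 0)"
            using eventually_at_right_less by (rule eventually_mono) (rule le[OF False])
        qed simp
        moreover have "norm (finite_hilbert f t) / (1 + norm (finite_hilbert f t)) \<le> norm (finite_hilbert f t)"
          by (rule saturate_le) simp
        ultimately show ?thesis by (simp add: indicator_def)
      qed
    qed
  qed
  also have "\<dots> = l * measure mu (space mu) + measure mu (B' \<inter> space mu)"
    using B' by (simp add: mu.emeasure_eq_measure)
  also have "B' \<inter> space mu = B'" using sets.sets_into_space[OF B'] by blast
  also have "measure mu (space mu) = 2"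
    by (simp add: space_restrict_space measure_restrict_space)
  finally show ?thesis using mB by (simp add: c_def)
qed

text \<open>
  In the preceding bound a small \<open>l\<close> is fixed first and the \<open>L\<^sup>1\<close>-norms are then sent to \<open>0\<close>.
\<close>

lemma L0_fnorm_finite_hilbert_tendsto:
  assumes f: "\<And>n::nat. integrable mu (f n)" and lim: "(\<lambda>n. LINT x|mu. norm (f n x)) \<longlonglongrightarrow> 0"
  shows "(\<lambda>n. L0_fnorm (finite_hilbert (f n))) \<longlonglongrightarrow> 0"
proof (rule LIMSEQ_I)
  fix r :: real assume r: "0 < r"
  define l where "l = r / 4"
  have l: "0 < l" using r by (simp add: l_def)
  have "(\<lambda>n. 2 * l + 2560 * pi * (LINT x|mu. norm (f n x)) / l) \<longlonglongrightarrow> 2 * l + 2560 * pi * 0 / l"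
    using l by (intro tendsto_intros lim) auto
  then have "eventually (\<lambda>n. 2 * l + 2560 * pi * (LINT x|mu. norm (f n x)) / l < r) sequentially"
    by (rule order_tendstoD) (use r in \<open>simp add: l_def\<close>)
  then have "eventually (\<lambda>n. norm (L0_fnorm (finite_hilbert (f n)) - 0) < r) sequentially"
  proof eventually_elim
    case (elim n)
    then show ?case using L0_fnorm_finite_hilbert_le[OF f l, of n] L0_fnorm_nonneg by (simp add: abs_of_nonneg)
  qed
  then show "\<exists>no. \<forall>n\<ge>no. norm (L0_fnorm (finite_hilbert (f n)) - 0) < r"
    by (simp add: eventually_sequentially)
qed

lemma L0_tendsto_unique:
  assumes "L0_tendsto F g" "L0_tendsto F h"
  shows "AE x in mu. g x = h x"
proof -
  have F: "F n \<in> L0" and gh: "g \<in> L0" "h \<in> L0" for n using assms by (auto simp: L0_tendsto_def)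
  have d: "(\<lambda>x. g x - h x) \<in> L0" using gh by measurable
  have "L0_fnorm (\<lambda>x. g x - h x) \<le> 0"
  proof (rule tendsto_lowerbound)
    show "(\<lambda>n. L0_fnorm (\<lambda>x. F n x - h x) + L0_fnorm (\<lambda>x. F n x - g x)) \<longlonglongrightarrow> 0"
      using assms by (auto simp: L0_tendsto_def intro!: tendsto_add_zero)
    show "eventually (\<lambda>n. L0_fnorm (\<lambda>x. g x - h x) \<le> L0_fnorm (\<lambda>x. F n x - h x) + L0_fnorm (\<lambda>x. F n x - g x)) sequentially"
    proof (rule always_eventually, rule allI)
      fix n
      have "L0_fnorm (\<lambda>x. (F n x - h x) + - (F n x - g x)) \<le> L0_fnorm (\<lambda>x. F n x - h x) + L0_fnorm (\<lambda>x. - (F n x - g x))"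
        using F[of n] gh by (intro L0_fnorm_triangle borel_measurable_diff borel_measurable_uminus) auto
      moreover have "L0_fnorm (\<lambda>x. - (F n x - g x)) = L0_fnorm (\<lambda>x. F n x - g x)"
        by (rule L0_fnorm_uminus)
      ultimately show "L0_fnorm (\<lambda>x. g x - h x) \<le> L0_fnorm (\<lambda>x. F n x - h x) + L0_fnorm (\<lambda>x. F n x - g x)"
        by (simp add: algebra_simps)
    qed
  qed simp
  then have "L0_fnorm (\<lambda>x. g x - h x) = 0" using L0_fnorm_nonneg[of "\<lambda>x. g x - h x"] by linarith
  from L0_fnorm_eq_0[OF d this] show ?thesis by eventually_elim simp
qed

lemma L0_tendsto_subseq:
  assumes "L0_tendsto F g" "strict_mono r"
  shows "L0_tendsto (\<lambda>k. F (r k)) g"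
  using assms LIMSEQ_subseq_LIMSEQ[of "\<lambda>n. L0_fnorm (\<lambda>x. F n x - g x)" 0 r]
  by (auto simp: L0_tendsto_def o_def)

lemma L0_tendsto_cong_AE:
  assumes "L0_tendsto F g" "\<And>n. F' n \<in> L0" "g' \<in> L0"
    and "\<And>n. AE x in mu. F n x = F' n x" "AE x in mu. g x = g' x"
  shows "L0_tendsto F' g'"
proof -
  have "L0_fnorm (\<lambda>x. F' n x - g' x) = L0_fnorm (\<lambda>x. F n x - g x)" for n
  proof (rule L0_fnorm_cong_AE)
    have "F n \<in> L0" "g \<in> L0" using assms(1) by (auto simp: L0_tendsto_def)
    then show "(\<lambda>x. F n x - g x) \<in> L0" by measurable
    show "(\<lambda>x. F' n x - g' x) \<in> L0" using assms(2)[of n] assms(3) by measurable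
    show "AE x in mu. F' n x - g' x = F n x - g x"
      using assms(4)[of n] assms(5) by eventually_elim simp
  qed
  then show ?thesis using assms by (simp add: L0_tendsto_def)
qed

lemma L0_tendsto_add:
  assumes "L0_tendsto F g" "L0_tendsto F' g'"
  shows "L0_tendsto (\<lambda>n x. F n x + F' n x) (\<lambda>x. g x + g' x)"
proof -
  have m: "F n \<in> L0" "F' n \<in> L0" "g \<in> L0" "g' \<in> L0" for n
    using assms by (auto simp: L0_tendsto_def)
  have "(\<lambda>n. L0_fnorm (\<lambda>x. (F n x + F' n x) - (g x + g' x))) \<longlonglongrightarrow> 0"
  proof (rule real_tendsto_sandwich[OF _ _ tendsto_const])
    show "(\<lambda>n. L0_fnorm (\<lambda>x. F n x - g x) + L0_fnorm (\<lambda>x. F' n x - g' x)) \<longlonglongrightarrow> 0"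
      using assms by (auto simp: L0_tendsto_def intro!: tendsto_add_zero)
    show "eventually (\<lambda>n. 0 \<le> L0_fnorm (\<lambda>x. (F n x + F' n x) - (g x + g' x))) sequentially"
      by (simp add: L0_fnorm_nonneg)
    have "L0_fnorm (\<lambda>x. (F n x + F' n x) - (g x + g' x)) \<le> L0_fnorm (\<lambda>x. F n x - g x) + L0_fnorm (\<lambda>x. F' n x - g' x)" for n
    proof -
      have "L0_fnorm (\<lambda>x. (F n x - g x) + (F' n x - g' x)) \<le> L0_fnorm (\<lambda>x. F n x - g x) + L0_fnorm (\<lambda>x. F' n x - g' x)"
        using m(1,2)[of n] m(3,4) by (intro L0_fnorm_triangle borel_measurable_diff borel_measurable_uminus) auto
      then show ?thesis by (simp add: algebra_simps)
    qed
    then show "eventually (\<lambda>n. L0_fnorm (\<lambda>x. (F n x + F' n x) - (g x + g' x))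
        \<le> L0_fnorm (\<lambda>x. F n x - g x) + L0_fnorm (\<lambda>x. F' n x - g' x)) sequentially"
      by simp
  qed
  moreover have "(\<lambda>x. F n x + F' n x) \<in> L0" "(\<lambda>x. g x + g' x) \<in> L0" for n
    using m(1,2)[of n] m(3,4) by measurable
  ultimately show ?thesis by (simp add: L0_tendsto_def)
qed

lemma L0_tendsto_const: "g \<in> L0 \<Longrightarrow> L0_tendsto (\<lambda>_. g) g"
  by (simp add: L0_tendsto_def L0_fnorm_def)

lemma L0_tendsto_finite_hilbert:
  assumes f: "integrable mu f" and s: "\<And>n::nat. integrable mu (s n)"
    and lim: "(\<lambda>n. LINT x|mu. norm (s n x - f x)) \<longlonglongrightarrow> 0"
  shows "L0_tendsto (\<lambda>n. finite_hilbert (s n)) (finite_hilbert f)"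
proof -
  have "(\<lambda>n. L0_fnorm (finite_hilbert (\<lambda>x. s n x - f x))) \<longlonglongrightarrow> 0"
    using f s by (intro L0_fnorm_finite_hilbert_tendsto lim) auto
  moreover have "L0_fnorm (\<lambda>t. finite_hilbert (s n) t - finite_hilbert f t) = L0_fnorm (finite_hilbert (\<lambda>x. s n x - f x))" for n
  proof (rule L0_fnorm_cong_AE)
    have "finite_hilbert (s n) \<in> L0" "finite_hilbert f \<in> L0"
      by (rule finite_hilbert_measurable[OF s] finite_hilbert_measurable[OF f])+
    then show "(\<lambda>t. finite_hilbert (s n) t - finite_hilbert f t) \<in> L0" by measurable
    show "finite_hilbert (\<lambda>x. s n x - f x) \<in> L0"
      using f s by (intro finite_hilbert_measurable) auto
    show "AE t in mu. finite_hilbert (s n) t - finite_hilbert f t = finite_hilbert (\<lambda>x. s n x - f x) t"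
      using finite_hilbert_diff_AE[OF s[of n] f] by eventually_elim simp
  qed
  ultimately show ?thesis
    using finite_hilbert_measurable[OF f] finite_hilbert_measurable[OF s] by (simp add: L0_tendsto_def)
qed

lemma finite_hilbert_zero_AE: "AE t in mu. finite_hilbert (\<lambda>_. 0) t = 0"
  using finite_hilbert_scale_AE[of "\<lambda>_. 0" 0] by simp

lemma L0_tendsto_finite_hilbert_zero:
  assumes s: "\<And>n::nat. integrable mu (s n)"
    and lim: "(\<lambda>n. LINT x|mu. norm (s n x)) \<longlonglongrightarrow> 0"
  shows "L0_tendsto (\<lambda>n. finite_hilbert (s n)) (\<lambda>_. 0)"
proof (rule L0_tendsto_cong_AE)
  show "L0_tendsto (\<lambda>n. finite_hilbert (s n)) (finite_hilbert (\<lambda>_. 0))"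
    using lim by (intro L0_tendsto_finite_hilbert s) auto
  show "finite_hilbert (s n) \<in> L0" for n by (rule finite_hilbert_measurable[OF s])
qed (auto simp: finite_hilbert_zero_AE)

lemma integrable_times_indicator:
  fixes f :: "real \<Rightarrow> complex"
  assumes "integrable mu f" "A \<in> sets mu"
  shows "integrable mu (\<lambda>x. f x * indicator A x)"
proof -
  have "(\<lambda>x. f x * indicator A x) = (\<lambda>x. indicator A x *\<^sub>R f x)" by (auto simp: indicator_def)
  then show ?thesis using integrable_mult_indicator[OF assms(2,1)] by simp
qed

lemma finite_hilbert_cong:
  assumes "\<And>x. x \<in> {-1<..<1} \<Longrightarrow> f x = g x"
  shows "finite_hilbert f = finite_hilbert g"
proof -
  have "truncated_hilbert e f t = truncated_hilbert e g t" for e t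
  proof -
    have "(LINT x:S|mu. f x / of_real (x - t)) = (LINT x:S|mu. g x / of_real (x - t))" for S
      unfolding set_lebesgue_integral_def using assms
      by (intro Bochner_Integration.integral_cong refl) (simp add: space_restrict_space)
    then show ?thesis unfolding truncated_hilbert_def by simp
  qed
  then show ?thesis by (simp add: finite_hilbert_def fun_eq_iff)
qed

section \<open>Setwise limits of Hilbert transforms\<close>

text \<open>
  The sets \<open>K j\<close> on which the whole sequence is bounded by \<open>j\<close> exhaust the interval. On a fixed \<open>K j\<close> the
  integrals of \<open>\<bar>u n\<bar>\<close> tend to \<open>0\<close> by bounded convergence, and for fixed \<open>n\<close> the integrals off \<open>K j\<close>
  tend to \<open>0\<close> as \<open>j\<close> grows. Choosing \<open>n\<close> and \<open>j\<close> alternately confines the essential part of each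
  chosen function to the difference of two consecutive \<open>K\<close>-sets.
\<close>

lemma gliding_hump:
  fixes u :: "nat \<Rightarrow> real \<Rightarrow> complex"
  assumes int: "\<And>n. integrable mu (u n)"
    and lim: "\<And>x. x \<in> space mu \<Longrightarrow> (\<lambda>n. u n x) \<longlonglongrightarrow> 0"
  obtains r :: "nat \<Rightarrow> nat" and D where "strict_mono r" "\<And>k. D k \<in> sets mu" "disjoint_family D"
    "(\<lambda>k. LINT x|mu. norm (u (r k) x * indicator (space mu - D k) x)) \<longlonglongrightarrow> 0"
proof -
  have [measurable]: "u n \<in> borel_measurable mu" for n using int by simp
  define K where "K j = {x \<in> space mu. \<forall>n. norm (u n x) \<le> real j}" for j
  have K[measurable]: "K j \<in> sets mu" for j unfolding K_def by measurable
  have K_mono: "K i \<subseteq> K j" if "i \<le> j" for i j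
    using that unfolding K_def by (auto intro: order_trans)
  define near where "near n j = (LINT x|mu. norm (u n x) * indicator (K j) x)" for n j
  define far where "far n j = (LINT x|mu. norm (u n x) * indicator (space mu - K j) x)" for n j
  have int_near: "integrable mu (\<lambda>x. norm (u n x) * indicator B x)" if "B \<in> sets mu" for n B
  proof -
    have "norm (u n x * indicator B x) = norm (u n x) * indicator B x" for x
      by (simp add: norm_mult indicator_def)
    then show ?thesis
      using integrable_norm[OF integrable_times_indicator[OF int that, of n]] by (simp only:)
  qed
  have near: "(\<lambda>n. near n j) \<longlonglongrightarrow> 0" for j
  proof -
    have "(\<lambda>n. near n j) \<longlonglongrightarrow> (LINT x|mu. 0)"
      unfolding near_def
    proof (rule integral_dominated_convergence[where w = "\<lambda>_. real j"])
      show "AE x in mu. (\<lambda>n. norm (u n x) * indicator (K j) x) \<longlonglongrightarrow> 0"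
        by (rule AE_I2) (auto intro!: tendsto_mult_left_zero tendsto_norm_zero lim)
      show "AE x in mu. norm (norm (u n x) * indicator (K j) x) \<le> real j" for n
        by (rule AE_I2) (auto simp: K_def indicator_def)
    qed auto
    then show ?thesis by simp
  qed
  have far: "(\<lambda>j. far n j) \<longlonglongrightarrow> 0" for n
  proof -
    have "(\<lambda>j. far n j) \<longlonglongrightarrow> (LINT x|mu. 0)"
      unfolding far_def
    proof (rule integral_dominated_convergence[where w = "\<lambda>x. norm (u n x)"])
      show "AE x in mu. (\<lambda>j. norm (u n x) * indicator (space mu - K j) x) \<longlonglongrightarrow> 0"
      proof (rule AE_I2)
        fix x assume x: "x \<in> space mu"
        have "Bseq (\<lambda>n. u n x)" using lim[OF x] by (intro convergent_imp_Bseq convergentI)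
        then obtain C where C: "\<And>n. norm (u n x) \<le> C" unfolding Bseq_def by blast
        obtain j0 where "C \<le> real j0" using real_arch_simple by blast
        then have "x \<in> K j0" using x C order_trans unfolding K_def by blast
        then have "x \<in> K j" if "j0 \<le> j" for j using K_mono[OF that] by blast
        then have "eventually (\<lambda>j. norm (u n x) * indicator (space mu - K j) x = 0) sequentially"
          unfolding eventually_sequentially by (intro exI[of _ j0]) auto
        then show "(\<lambda>j. norm (u n x) * indicator (space mu - K j) x) \<longlonglongrightarrow> 0"
          by (rule tendsto_eventually)
      qed
      show "AE x in mu. norm (norm (u n x) * indicator (space mu - K j) x) \<le> norm (u n x)" for j
        by (rule AE_I2) (auto simp: indicator_def)
      show "(\<lambda>x. norm (u n x) * indicator (space mu - K j) x) \<in> borel_measurable mu" for j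
        by measurable
    qed (use int in auto)
    then show ?thesis by simp
  qed
  have step: "\<exists>n j. m < n \<and> i \<le> j \<and> near n i < 1 / real (Suc k) \<and> far n j < 1 / real (Suc k)" for k m i :: nat
  proof -
    have "eventually (\<lambda>n. near n i < 1 / real (Suc k)) sequentially"
      using near by (rule order_tendstoD) simp
    then have "eventually (\<lambda>n. m < n \<and> near n i < 1 / real (Suc k)) sequentially"
      using eventually_gt_at_top[of m] by eventually_elim simp
    then obtain n where n: "m < n" "near n i < 1 / real (Suc k)"
      using eventually_happens' sequentially_bot by blast
    have "eventually (\<lambda>j. far n j < 1 / real (Suc k)) sequentially"
      using far by (rule order_tendstoD) simp
    then have "eventually (\<lambda>j. i \<le> j \<and> far n j < 1 / real (Suc k)) sequentially"
      using eventually_ge_at_top[of i] by eventually_elim simp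
    then obtain j where "i \<le> j" "far n j < 1 / real (Suc k)"
      using eventually_happens' sequentially_bot by blast
    with n show ?thesis by blast
  qed
  \<comment> \<open>A state \<open>(n, i, j)\<close> consists of the index of a function and of the inner and outer sets of its
    hump; the outer set of one hump is the inner set of the next, which makes the humps disjoint.\<close>
  define P where "P k s \<longleftrightarrow> near (fst s) (fst (snd s)) < 1 / real (Suc k) \<and> far (fst s) (snd (snd s)) < 1 / real (Suc k) \<and>
      fst (snd s) \<le> snd (snd s)" for k and s :: "nat \<times> nat \<times> nat"
  have "\<exists>S. \<forall>k. P k (S k) \<and> (fst (S k) < fst (S (Suc k)) \<and> fst (snd (S (Suc k))) = snd (snd (S k)))"
  proof (rule dependent_nat_choice)
    obtain n j where "near n 0 < 1 / real (Suc 0)" "far n j < 1 / real (Suc 0)"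
      using step[of 0 0 0] by blast
    then show "\<exists>s. P 0 s" by (intro exI[of _ "(n, 0, j)"]) (simp add: P_def)
    fix s :: "nat \<times> nat \<times> nat" and k
    obtain n j where "fst s < n" "snd (snd s) \<le> j" "near n (snd (snd s)) < 1 / real (Suc (Suc k))"
        "far n j < 1 / real (Suc (Suc k))"
      using step[of "fst s" "snd (snd s)" "Suc k"] by blast
    then show "\<exists>s'. P (Suc k) s' \<and> (fst s < fst s' \<and> fst (snd s') = snd (snd s))"
      by (intro exI[of _ "(n, snd (snd s), j)"]) (simp add: P_def)
  qed
  then obtain S where S: "\<forall>k. P k (S k) \<and> (fst (S k) < fst (S (Suc k)) \<and> fst (snd (S (Suc k))) = snd (snd (S k)))"
    by (elim exE)
  define r where "r k = fst (S k)" for k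
  define a where "a k = fst (snd (S k))" for k
  have r_Suc: "r k < r (Suc k)" for k using S by (simp add: r_def)
  have ar: "a k \<le> a (Suc k)" "near (r k) (a k) < 1 / real (Suc k)" "far (r k) (a (Suc k)) < 1 / real (Suc k)" for k
    using S[rule_format, of k] unfolding P_def r_def a_def by auto
  have a_mono: "a k \<le> a l" if "k \<le> l" for k l
    using lift_Suc_mono_le[of a k l] ar(1) that by blast
  define D where "D k = K (a (Suc k)) - K (a k)" for k
  have D: "D k \<in> sets mu" for k unfolding D_def by measurable
  have disj: "D k \<inter> D l = {}" if "k < l" for k l
    using K_mono[OF a_mono[of "Suc k" l]] that by (auto simp: D_def)
  show ?thesis
  proof (rule that)
    show "strict_mono r" using r_Suc by (simp add: strict_mono_Suc_iff)
    show "D k \<in> sets mu" for k by (rule D)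
    show "disjoint_family D"
      unfolding disjoint_family_on_def by (metis disj inf_commute linorder_neqE_nat)
    show "(\<lambda>k. LINT x|mu. norm (u (r k) x * indicator (space mu - D k) x)) \<longlonglongrightarrow> 0"
    proof (rule real_tendsto_sandwich[OF _ _ tendsto_const])
      show "eventually (\<lambda>k. 0 \<le> (LINT x|mu. norm (u (r k) x * indicator (space mu - D k) x))) sequentially"
        by simp
      have "(LINT x|mu. norm (u (r k) x * indicator (space mu - D k) x)) \<le> 2 * (1 / real (Suc k))" for k
      proof -
        have "(LINT x|mu. norm (u (r k) x * indicator (space mu - D k) x))
          \<le> (LINT x|mu. norm (u (r k) x) * indicator (K (a k)) x + norm (u (r k) x) * indicator (space mu - K (a (Suc k))) x)"
        proof (rule Bochner_Integration.integral_mono)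
          show "integrable mu (\<lambda>x. norm (u (r k) x * indicator (space mu - D k) x))"
            by (intro integrable_norm integrable_times_indicator int sets.compl_sets D)
          show "integrable mu (\<lambda>x. norm (u (r k) x) * indicator (K (a k)) x + norm (u (r k) x) * indicator (space mu - K (a (Suc k))) x)"
            by (intro Bochner_Integration.integrable_add int_near sets.compl_sets K)
        qed (auto simp: indicator_def D_def norm_mult)
        also have "\<dots> = near (r k) (a k) + far (r k) (a (Suc k))"
          unfolding near_def far_def by (intro Bochner_Integration.integral_add int_near sets.compl_sets K)
        finally show ?thesis using ar(2,3)[of k] by linarith
      qed
      then show "eventually (\<lambda>k. (LINT x|mu. norm (u (r k) x * indicator (space mu - D k) x)) \<le> 2 * (1 / real (Suc k))) sequentially"
        by (intro always_eventually allI)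
      show "(\<lambda>k. 2 * (1 / real (Suc k))) \<longlonglongrightarrow> 0"
        using tendsto_mult_left[OF LIMSEQ_inverse_real_of_nat, of 2] by (simp add: inverse_eq_divide)
    qed
  qed
qed

text \<open>
  Let \<open>A'\<close> be the part of \<open>A\<close> in the humps of even index. The transforms of odd index see nothing of their
  humps on \<open>A'\<close>, so they tend to \<open>0\<close> there and the limit belonging to \<open>A'\<close> vanishes. The transforms of
  even index see nothing of their humps on \<open>A - A'\<close>, so the limit belonging to \<open>A\<close> equals the one
  belonging to \<open>A'\<close>.
\<close>

theorem finite_hilbert_setwise_limit_zero:
  fixes u :: "nat \<Rightarrow> real \<Rightarrow> complex"
  assumes int: "\<And>n. integrable mu (u n)"
    and lim: "\<And>x. x \<in> space mu \<Longrightarrow> (\<lambda>n. u n x) \<longlonglongrightarrow> 0"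
    and conv: "\<And>A. A \<in> sets mu \<Longrightarrow> \<exists>h. L0_tendsto (\<lambda>n. finite_hilbert (\<lambda>x. u n x * indicator A x)) h"
    and A: "A \<in> sets mu" and h: "L0_tendsto (\<lambda>n. finite_hilbert (\<lambda>x. u n x * indicator A x)) h"
  shows "AE x in mu. h x = 0"
proof -
  obtain r D where r: "strict_mono r" and D: "\<And>k. D k \<in> sets mu" "disjoint_family D"
    and small: "(\<lambda>k. LINT x|mu. norm (u (r k) x * indicator (space mu - D k) x)) \<longlonglongrightarrow> 0"
    by (rule gliding_hump[OF int lim]) auto
  let ?T = "\<lambda>n A. finite_hilbert (\<lambda>x. u n x * indicator A x)"
  have T: "?T n B \<in> L0" if "B \<in> sets mu" for n B
    by (intro finite_hilbert_measurable integrable_times_indicator int that)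
  have off_hump: "L0_tendsto (\<lambda>k. ?T (r (q k)) B) (\<lambda>_. 0)"
    if B: "B \<in> sets mu" and q: "strict_mono q" and disj: "\<And>k. B \<inter> D (q k) = {}" for B q
  proof (rule L0_tendsto_finite_hilbert_zero)
    show "integrable mu (\<lambda>x. u (r (q k)) x * indicator B x)" for k
      by (intro integrable_times_indicator int B)
    show "(\<lambda>k. LINT x|mu. norm (u (r (q k)) x * indicator B x)) \<longlonglongrightarrow> 0"
    proof (rule real_tendsto_sandwich[OF _ _ tendsto_const])
      show "(\<lambda>k. LINT x|mu. norm (u (r (q k)) x * indicator (space mu - D (q k)) x)) \<longlonglongrightarrow> 0"
        using LIMSEQ_subseq_LIMSEQ[OF small q] by (simp add: o_def)
      have "(LINT x|mu. norm (u (r (q k)) x * indicator B x)) \<le> (LINT x|mu. norm (u (r (q k)) x * indicator (space mu - D (q k)) x))" for k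
      proof (rule Bochner_Integration.integral_mono)
        show "norm (u (r (q k)) x * indicator B x) \<le> norm (u (r (q k)) x * indicator (space mu - D (q k)) x)"
          if "x \<in> space mu" for x
          using disj[of k] that by (auto simp: indicator_def norm_mult)
      qed (intro integrable_norm integrable_times_indicator int B sets.compl_sets D)+
      then show "eventually (\<lambda>k. (LINT x|mu. norm (u (r (q k)) x * indicator B x))
          \<le> (LINT x|mu. norm (u (r (q k)) x * indicator (space mu - D (q k)) x))) sequentially"
        by (intro always_eventually allI)
    qed simp
  qed
  define A' where "A' = A \<inter> (\<Union>k. D (2 * k))"
  have A': "A' \<in> sets mu" "A - A' \<in> sets mu" using A D(1) by (auto simp: A'_def)
  obtain h' where h': "L0_tendsto (\<lambda>n. ?T n A') h'" using conv[OF A'(1)] by blast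
  have mono: "strict_mono (\<lambda>k::nat. 2 * k)" "strict_mono (\<lambda>k::nat. 2 * k + 1)"
    by (auto simp: strict_mono_def)
  have sub: "strict_mono (\<lambda>k. r (2 * k))" "strict_mono (\<lambda>k. r (2 * k + 1))"
    using strict_mono_o[OF r mono(1)] strict_mono_o[OF r mono(2)] by (simp_all add: o_def)
  have D_disj: "D i \<inter> D j = {}" if "i \<noteq> j" for i j
    using disjoint_family_onD[OF D(2), of i j] that by simp
  have "A' \<inter> D (2 * k + 1) = {}" for k
  proof -
    have "D (2 * j) \<inter> D (2 * k + 1) = {}" for j by (rule D_disj) presburger
    then show ?thesis unfolding A'_def by blast
  qed
  then have "L0_tendsto (\<lambda>k. ?T (r (2 * k + 1)) A') (\<lambda>_. 0)"
    by (intro off_hump[OF A'(1) mono(2)])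
  then have h'0: "AE x in mu. h' x = 0"
    using L0_tendsto_unique[OF L0_tendsto_subseq[OF h' sub(2)]] by blast
  have even: "L0_tendsto (\<lambda>k. ?T (r (2 * k)) A') (\<lambda>_. 0)"
    by (rule L0_tendsto_cong_AE[OF L0_tendsto_subseq[OF h' sub(1)]]) (use T A' h'0 in auto)
  have "(A - A') \<inter> D (2 * k) = {}" for k unfolding A'_def by blast
  then have rest: "L0_tendsto (\<lambda>k. ?T (r (2 * k)) (A - A')) (\<lambda>_. 0)"
    by (intro off_hump[OF A'(2) mono(1)])
  have "L0_tendsto (\<lambda>k. ?T (r (2 * k)) A) (\<lambda>_. 0)"
  proof (rule L0_tendsto_cong_AE[OF L0_tendsto_add[OF even rest]])
    show "AE t in mu. ?T (r (2 * n)) A' t + ?T (r (2 * n)) (A - A') t = ?T (r (2 * n)) A t" for n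
    proof -
      have eq: "u m x * indicator A' x + u m x * indicator (A - A') x = u m x * indicator A x" for m x
        by (auto simp: A'_def indicator_def)
      show ?thesis
        using finite_hilbert_add_AE[OF integrable_times_indicator[OF int A'(1)] integrable_times_indicator[OF int A'(2)], of "r (2 * n)" "r (2 * n)"]
        unfolding eq by eventually_elim simp
    qed
  qed (use T A in auto)
  from L0_tendsto_unique[OF L0_tendsto_subseq[OF h sub(1)] this] show ?thesis .
qed

section \<open>Integration with respect to the Hilbert vector measure\<close>

lemma finite_hilbert_mem_of_dominated:
  assumes "f \<in> hilbert_domain X" "h \<in> L0" "AE x in mu. norm (h x) \<le> norm (f x)"
  shows "finite_hilbert h \<in> X"
  using assms by (simp add: hilbert_domain_def)

lemma simple_function_integrable_mu:
  fixes s :: "real \<Rightarrow> complex"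
  assumes "simple_function mu s"
  shows "integrable mu s"
proof (rule mu.integrable_const_bound)
  have fin: "finite (s ` space mu)" using assms by (rule simple_functionD)
  show "AE x in mu. norm (s x) \<le> Max (norm ` s ` space mu)"
    by (rule AE_I2) (use fin in \<open>auto intro!: Max_ge\<close>)
qed (rule borel_measurable_simple_function[OF assms])

context banach_function_space
begin

lemma hilbert_measure_eq:
  assumes "B \<in> sets mu"
  shows "hilbert_measure X B = finite_hilbert (indicator B)"
proof -
  have "indicator B \<in> X" by (intro simple_mem simple_function_indicator assms)
  then show ?thesis by (simp add: hilbert_measure_def hilbert_on_def)
qed

text \<open>
  The integral of a simple function is a finite combination of transforms of indicators, and the transform
  is additive almost everywhere, finitely many null sets being discarded.
\<close>

lemma simple_vint_hilbert:
  assumes s: "simple_function mu s" and A: "A \<in> sets mu"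
  shows "simple_vint (hilbert_measure X) A s \<in> L0"
    and "AE t in mu. simple_vint (hilbert_measure X) A s t = finite_hilbert (\<lambda>x. s x * indicator A x) t"
proof -
  define I where "I = s ` space mu"
  define B where "B a = (s -` {a} \<inter> space mu) \<inter> A" for a
  have I: "finite I" unfolding I_def using s by (rule simple_functionD)
  have B: "B a \<in> sets mu" for a
    unfolding B_def using simple_functionD(2)[OF s] A by auto
  have intB: "integrable mu (indicator (B a) :: real \<Rightarrow> complex)" for a
    using integrable_times_indicator[of "\<lambda>_. 1" "B a"] B by simp
  have vint: "simple_vint (hilbert_measure X) A s = (\<lambda>t. \<Sum>a\<in>I. a * finite_hilbert (indicator (B a)) t)"
    unfolding simple_vint_def I_def[symmetric] B_def[symmetric] hilbert_measure_eq[OF B] ..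
  show "simple_vint (hilbert_measure X) A s \<in> L0"
    unfolding vint
    by (intro borel_measurable_sum borel_measurable_times borel_measurable_const finite_hilbert_measurable intB)
  have "(\<Sum>a\<in>I. a * indicator (B a) x) = s x * indicator A x" if "x \<in> {-1<..<1}" for x
  proof -
    have x: "x \<in> space mu" using that by (simp add: space_restrict_space)
    have "(\<Sum>a\<in>I. a * indicator (B a) x) = (\<Sum>a\<in>I. if a = s x then a * indicator A x else 0)"
      using x by (intro sum.cong refl) (auto simp: B_def indicator_def)
    also have "\<dots> = s x * indicator A x" using I x by (simp add: I_def)
    finally show ?thesis .
  qed
  then have eq: "finite_hilbert (\<lambda>x. \<Sum>a\<in>I. a * indicator (B a) x) = finite_hilbert (\<lambda>x. s x * indicator A x)"
    by (rule finite_hilbert_cong)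
  have "AE t in mu. finite_hilbert (\<lambda>x. \<Sum>a\<in>I. a * indicator (B a) x) t = (\<Sum>a\<in>I. finite_hilbert (\<lambda>x. a * indicator (B a) x) t)"
    by (intro finite_hilbert_sum_AE I integrable_mult_right intB)
  moreover have "AE t in mu. \<forall>a\<in>I. finite_hilbert (\<lambda>x. a * indicator (B a) x) t = a * finite_hilbert (indicator (B a)) t"
    by (intro AE_finite_allI I finite_hilbert_scale_AE intB)
  ultimately show "AE t in mu. simple_vint (hilbert_measure X) A s t = finite_hilbert (\<lambda>x. s x * indicator A x) t"
    by eventually_elim (simp add: vint flip: eq)
qed

text \<open>
  Independence of the approximating sequence: the differences \<open>s n - f\<close> tend to \<open>0\<close> pointwise and their
  transforms over every set converge in measure, so the limits vanish.
\<close>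

lemma vector_integral_limit:
  assumes f: "integrable mu f" and s: "approximating (hilbert_measure X) f s"
    and A: "A \<in> sets mu" and g: "L0_tendsto (\<lambda>n. simple_vint (hilbert_measure X) A (s n)) g"
  shows "AE t in mu. g t = finite_hilbert (\<lambda>x. f x * indicator A x) t"
proof -
  have simp_s: "simple_function mu (s n)" for n using s by (simp add: approximating_def)
  have ints: "integrable mu (s n)" for n by (rule simple_function_integrable_mu[OF simp_s])
  define u where "u n x = s n x - f x" for n x
  have intu: "integrable mu (u n)" for n unfolding u_def using ints f by simp
  have transfer: "L0_tendsto (\<lambda>n. finite_hilbert (\<lambda>x. u n x * indicator A x))
       (\<lambda>t. g t + - finite_hilbert (\<lambda>x. f x * indicator A x) t)"
    if A: "A \<in> sets mu" and g: "L0_tendsto (\<lambda>n. simple_vint (hilbert_measure X) A (s n)) g" for A g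
  proof -
    let ?Tf = "finite_hilbert (\<lambda>x. f x * indicator A x)"
    have Tf: "?Tf \<in> L0" by (intro finite_hilbert_measurable integrable_times_indicator f A)
    then have mTf: "(\<lambda>t. - ?Tf t) \<in> L0" by measurable
    have gL: "g \<in> L0" using g by (simp add: L0_tendsto_def)
    show ?thesis
    proof (rule L0_tendsto_cong_AE[OF L0_tendsto_add[OF g L0_tendsto_const[OF mTf]]])
      show "finite_hilbert (\<lambda>x. u n x * indicator A x) \<in> L0" for n
        by (intro finite_hilbert_measurable integrable_times_indicator intu A)
      show "(\<lambda>t. g t + - ?Tf t) \<in> L0" using gL Tf by measurable
      show "AE t in mu. simple_vint (hilbert_measure X) A (s n) t + - ?Tf t = finite_hilbert (\<lambda>x. u n x * indicator A x) t" for n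
      proof -
        have eq: "u n x * indicator A x = s n x * indicator A x - f x * indicator A x" for x
          by (simp add: u_def left_diff_distrib)
        show ?thesis
          using simple_vint_hilbert(2)[OF simp_s A, of n]
            finite_hilbert_diff_AE[OF integrable_times_indicator[OF ints A] integrable_times_indicator[OF f A], of n]
          unfolding eq by eventually_elim simp
      qed
    qed simp
  qed
  have "AE t in mu. g t + - finite_hilbert (\<lambda>x. f x * indicator A x) t = 0"
  proof (rule finite_hilbert_setwise_limit_zero[OF intu _ _ A transfer[OF A g]])
    show "(\<lambda>n. u n x) \<longlonglongrightarrow> 0" if "x \<in> space mu" for x
    proof -
      have "(\<lambda>n. s n x) \<longlonglongrightarrow> f x" using s that by (simp add: approximating_def)
      then show ?thesis unfolding u_def by (rule LIM_zero)
    qed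
    show "\<exists>h. L0_tendsto (\<lambda>n. finite_hilbert (\<lambda>x. u n x * indicator C x)) h" if C: "C \<in> sets mu" for C
    proof -
      obtain g' where "L0_tendsto (\<lambda>n. simple_vint (hilbert_measure X) C (s n)) g'"
        using s C by (auto simp: approximating_def)
      from transfer[OF C this] show ?thesis by blast
    qed
  qed
  then show ?thesis by eventually_elim simp
qed

text \<open>
  Simple functions dominated by \<open>2 \<bar>f\<bar>\<close> converge in \<open>L\<^sup>1\<close>, also after restriction to a set, and \<open>T\<close> is
  continuous from \<open>L\<^sup>1\<close> to \<open>L\<^sup>0\<close>.
\<close>

lemma dominated_simple_approximation:
  assumes f: "integrable mu f"
  shows "\<exists>s. approximating (hilbert_measure X) f s \<and> (\<forall>A\<in>sets mu.
      L0_tendsto (\<lambda>n. simple_vint (hilbert_measure X) A (s n)) (finite_hilbert (\<lambda>x. f x * indicator A x)))"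
proof -
  have fm: "f \<in> borel_measurable mu" using f by simp
  obtain s where approx: "\<forall>i. simple_function mu (s i)" "\<forall>x\<in>space mu. (\<lambda>i. s i x) \<longlonglongrightarrow> f x"
      "\<forall>i. \<forall>x\<in>space mu. dist (s i x) 0 \<le> 2 * dist (f x) 0"
    using borel_measurable_implies_sequence_metric[OF fm, of 0] by blast
  then have s: "simple_function mu (s i)" for i by blast
  have lim: "(\<lambda>i. s i x) \<longlonglongrightarrow> f x" if "x \<in> space mu" for x
    using approx(2) that by blast
  have le: "norm (s i x) \<le> 2 * norm (f x)" if "x \<in> space mu" for i x
    using approx(3)[rule_format, OF that, of i] by simp
  have ints: "integrable mu (s n)" for n by (rule simple_function_integrable_mu[OF s])
  have conv: "L0_tendsto (\<lambda>n. simple_vint (hilbert_measure X) A (s n)) (finite_hilbert (\<lambda>x. f x * indicator A x))"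
    if A: "A \<in> sets mu" for A
  proof -
    note iA = integrable_times_indicator[OF _ A]
    have "(\<lambda>n. LINT x|mu. norm (f x * indicator A x - s n x * indicator A x)) \<longlonglongrightarrow> 0"
    proof (rule L1_dominated_convergence[where w = "\<lambda>x. 3 * norm (f x)"])
      show "(\<lambda>i. s i x * indicator A x) \<longlonglongrightarrow> f x * indicator A x" if "x \<in> space mu" for x
        by (intro tendsto_mult_right lim that)
      show "norm (f x * indicator A x - s i x * indicator A x) \<le> 3 * norm (f x)" if "x \<in> space mu" for i x
        using norm_triangle_ineq4[of "f x" "s i x"] le[OF that, of i] by (auto simp: indicator_def)
    qed (use borel_measurable_integrable[OF iA[OF f]] borel_measurable_integrable[OF iA[OF ints]] f in auto)
    then have "L0_tendsto (\<lambda>n. finite_hilbert (\<lambda>x. s n x * indicator A x)) (finite_hilbert (\<lambda>x. f x * indicator A x))"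
      by (intro L0_tendsto_finite_hilbert iA f ints) (simp add: norm_minus_commute)
    then show ?thesis
    proof (rule L0_tendsto_cong_AE)
      show "AE t in mu. finite_hilbert (\<lambda>x. s n x * indicator A x) t = simple_vint (hilbert_measure X) A (s n) t" for n
        using simple_vint_hilbert(2)[OF s A, of n] by eventually_elim simp
    qed (use simple_vint_hilbert(1)[OF s A] in \<open>auto intro!: finite_hilbert_measurable iA f\<close>)
  qed
  have "approximating (hilbert_measure X) f s"
    unfolding approximating_def using s lim conv by blast
  with conv show ?thesis by blast
qed

lemma vm_integrable_hilbert_measure:
  assumes f: "integrable mu f"
  shows "vm_integrable (hilbert_measure X) f"
proof -
  have "f \<in> L0" using f by simp
  with dominated_simple_approximation[OF f] show ?thesis unfolding vm_integrable_def by blast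
qed

lemma vm_integral_hilbert_measure:
  assumes f: "integrable mu f" and A: "A \<in> sets mu"
  shows "vm_integral (hilbert_measure X) A f \<in> L0"
    and "AE t in mu. vm_integral (hilbert_measure X) A f t = finite_hilbert (\<lambda>x. f x * indicator A x) t"
proof -
  have "\<exists>g s. approximating (hilbert_measure X) f s \<and> L0_tendsto (\<lambda>n. simple_vint (hilbert_measure X) A (s n)) g"
    using dominated_simple_approximation[OF f] A by blast
  then have "\<exists>s. approximating (hilbert_measure X) f s \<and>
      L0_tendsto (\<lambda>n. simple_vint (hilbert_measure X) A (s n)) (vm_integral (hilbert_measure X) A f)"
    unfolding vm_integral_def by (rule someI_ex)
  then obtain s' where s': "approximating (hilbert_measure X) f s'"
      "L0_tendsto (\<lambda>n. simple_vint (hilbert_measure X) A (s' n)) (vm_integral (hilbert_measure X) A f)"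
    by (elim exE conjE)
  then show "vm_integral (hilbert_measure X) A f \<in> L0" by (simp add: L0_tendsto_def)
  show "AE t in mu. vm_integral (hilbert_measure X) A f t = finite_hilbert (\<lambda>x. f x * indicator A x) t"
    by (rule vector_integral_limit[OF f s'(1) A s'(2)])
qed

text \<open>
  The function \<open>f \<chi>\<^sub>A\<close> is dominated by \<open>f\<close>, so its transform lies in \<open>X\<close>; membership passes to the
  integral, which agrees with it almost everywhere, by solidity of \<open>X\<close>.
\<close>

lemma vm_integral_mem_optimal_domain:
  assumes f: "f \<in> hilbert_domain X" and A: "A \<in> sets mu"
  shows "vm_integral (hilbert_measure X) A f \<in> X"
proof -
  have int: "integrable mu f" using f by (simp add: hilbert_domain_def)
  have "(\<lambda>x. f x * indicator A x) \<in> L0"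
    by (rule borel_measurable_integrable[OF integrable_times_indicator[OF int A]])
  moreover have "AE x in mu. norm (f x * indicator A x) \<le> norm (f x)"
    by (rule AE_I2) (simp add: indicator_def)
  ultimately have "finite_hilbert (\<lambda>x. f x * indicator A x) \<in> X"
    by (rule finite_hilbert_mem_of_dominated[OF f])
  then show ?thesis
  proof (rule solid)
    show "vm_integral (hilbert_measure X) A f \<in> L0" by (rule vm_integral_hilbert_measure[OF int A])
    show "AE t in mu. norm (vm_integral (hilbert_measure X) A f t) \<le> norm (finite_hilbert (\<lambda>x. f x * indicator A x) t)"
      using vm_integral_hilbert_measure(2)[OF int A] by eventually_elim simp
  qed
qed

end

theorem proposition4p4:
  fixes X :: "(real \<Rightarrow> complex) set" and N :: "(real \<Rightarrow> complex) \<Rightarrow> real"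
  assumes "ri_space X N"
    and "0 < lower_boyd X N"
    and "lower_boyd X N \<le> upper_boyd X N"
    and "upper_boyd X N < 1"
  shows "(\<forall>f. integrable mu f \<longrightarrow>
            vm_integrable (hilbert_measure X) f \<and>
            (\<forall>A\<in>sets mu.
               finite_hilbert (\<lambda>x. f x * indicator A x) \<in> L0 \<and>
               (AE t in mu. vm_integral (hilbert_measure X) A f t
                              = finite_hilbert (\<lambda>x. f x * indicator A x) t))) \<and>
         (\<forall>f\<in>hilbert_domain X.
            (\<forall>A\<in>sets mu. vm_integral (hilbert_measure X) A f \<in> X) \<and>
            finite_hilbert f \<in> X \<and>
            (AE t in mu. finite_hilbert f t
                           = vm_integral (hilbert_measure X) {-1<..<1} f t))"
proof (intro conjI allI impI ballI)
  interpret banach_function_space X N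
    using assms(1) by (rule ri_space.axioms)
  fix f :: "real \<Rightarrow> complex"
  {
    assume f: "integrable mu f"
    show "vm_integrable (hilbert_measure X) f"
      by (rule vm_integrable_hilbert_measure[OF f])
    fix A assume A: "A \<in> sets mu"
    show "finite_hilbert (\<lambda>x. f x * indicator A x) \<in> L0"
      by (intro finite_hilbert_measurable integrable_times_indicator f A)
    show "AE t in mu. vm_integral (hilbert_measure X) A f t = finite_hilbert (\<lambda>x. f x * indicator A x) t"
      by (rule vm_integral_hilbert_measure(2)[OF f A])
  next
    assume f: "f \<in> hilbert_domain X"
    then have int: "integrable mu f" by (simp add: hilbert_domain_def)
    show "vm_integral (hilbert_measure X) A f \<in> X" if "A \<in> sets mu" for A
      by (rule vm_integral_mem_optimal_domain[OF f that])
    show "finite_hilbert f \<in> X"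
      by (rule finite_hilbert_mem_of_dominated[OF f borel_measurable_integrable[OF int]]) simp
    have whole: "{-1<..<1} \<in> sets mu" by (simp add: sets_restrict_space_iff)
    have "finite_hilbert (\<lambda>x. f x * indicator {-1<..<1} x) = finite_hilbert f"
      by (rule finite_hilbert_cong) simp
    with vm_integral_hilbert_measure(2)[OF int whole]
    show "AE t in mu. finite_hilbert f t = vm_integral (hilbert_measure X) {-1<..<1} f t"
      by (simp add: eq_commute)
  }
qed

end
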